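(* Suppose that either $\beta_1'\ne 0$ or $\beta_2'\neq 0$. Then $A$ is isomorphic to $M_n(R_1)\oplus M_n(R_2)\oplus\cdots\oplus M_n(R_t)$ for some $t$, where the $R_j$ are commutative local rings.
   Context: Let $\mathbf{K}$ be an algebraically closed field of characteristic zero, $n\ge 2$, $q\in\mathbf{K}$ a primitive $n$-th root of unity, $m\ge 1$, $N=mn(n-1)$, and let $n_1,n_2,n_3$ be integers with $1\le n_1\le n$, $2\nmid(n,n_1)$, $n_1<m(n-1)$, $0\le n_2,n_3<n-1$. Let $(\beta_1,\beta_2,\beta_3)\in\mathbf{K}^3$. Let $\omega$ be a primitive $N$-th root of unity and $\omega_0=\omega^n$, a primitive $m(n-1)$-th root of unity. Fix $i\in\{0,1,\dots,m(n-1)-1\}$ and put $\beta_1'=\beta_1(\omega_0^{-n_1i}-\omega_0^{-mn_2i})$, and $\beta_2'=\beta_2(\omega_0^{-n_1i}-\omega_0^{-mn_3i})$ if $\beta_3=0$, $\beta_2'=\beta_2\beta_3^{-n}(\omega_0^{n_1i}-\omega_0^{(2n_1-mn_3)i})$ if $\beta_3\ne0$. $A$ is the $\mathbf{K}$-algebra generated by $g,x,y$ with relations $g^n=1$, $x^n=\beta_1'$, $y^n=\beta_2'$, $gx=q^{-1}xg$, $gy=qyg$, and $yx-q^{-n_1}xy=0$ if $\beta_3=0$, $yx-q^{-n_1}xy=g^{2n_1}-\omega^{2n_1i-mn(n_2+n_3)i}$ if $\beta_3\neq 0$. (These algebras, for $i=0,\dots,m(n-1)-1$, are the direct summands of the finite-dimensional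 Hopf algebra $H_{\alpha,\beta}$, $\alpha=(n,m,n_1,n_2,n_3)$, generated by $a,x,y$ with $a^{N}=1$, $x^n=\beta_1(a^{n_1n}-a^{mnn_2})$, $y^n=\beta_2(a^{n_1n}-a^{mnn_3})$, $xa=qax$, $ya=q^{-1}ay$, $yx-q^{-n_1}xy=\beta_3(a^{2n_1}-a^{mn(n_2+n_3)})$.) *)

theory Defs
  imports
    "HOL-Algebra.Algebraic_Closure_Type"
    "HOL-Algebra.Chinese_Remainder"
    "HOL-Library.Poly_Mapping"
begin

definition primitive_root_of_unity :: "nat \<Rightarrow> 'k::field \<Rightarrow> bool" where
  "primitive_root_of_unity d z \<longleftrightarrow> d > 0 \<and> z ^ d = 1 \<and> (\<forall>e. 0 < e \<and> e < d \<longrightarrow> z ^ e \<noteq> 1)"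

section \<open>Free algebras\<close>

text \<open>
  Words form the free monoid, written additively so that the convolution product of
  \<^theory>\<open>HOL-Library.Poly_Mapping\<close> applies: the free algebra on \<open>'g\<close> is the monoid algebra
  of \<open>'g word\<close>.
\<close>

datatype 'g word = Word (letters: "'g list")

instantiation word :: (type) monoid_add
begin

definition zero_word :: "'a word" where
  "zero_word = Word []"

definition plus_word :: "'a word \<Rightarrow> 'a word \<Rightarrow> 'a word" where
  "plus_word u v = Word (letters u @ letters v)"

instance
  by standard (simp_all add: zero_word_def plus_word_def)

end

type_synonym ('g, 'k) free_alg = "'g word \<Rightarrow>\<^sub>0 'k"

definition var :: "'g \<Rightarrow> ('g, 'k::field) free_alg" where
  "var s = Poly_Mapping.single (Word [s]) 1"

definition scal :: "'k \<Rightarrow> ('g, 'k::field) free_alg" where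
  "scal c = Poly_Mapping.single 0 c"

definition free_algebra :: "('k::field, ('g, 'k) free_alg) module" where
  "free_algebra = ring.extend ring_of_type_algebra (module.fields (\<lambda>c p. scal c * p))"

section \<open>Constructions with algebras\<close>

text \<open>
  A (not necessarily commutative) \<open>K\<close>-algebra is represented by a record of type
  \<^typ>\<open>('k, 'a) module\<close>. The library predicate \<^const>\<open>algebra\<close> covers commutative
  algebras only.
\<close>

definition quot_algebra :: "('k, 'a) module \<Rightarrow> 'a set \<Rightarrow> ('k, 'a set) module" where
  "quot_algebra A I = ring.extend (A Quot I)
     (module.fields (\<lambda>c S. \<Union>s\<in>S. I +>\<^bsub>A\<^esub> (c \<odot>\<^bsub>A\<^esub> s)))"

text \<open>The ideal \<^const>\<open>genideal\<close> is two-sided.\<close>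

definition presented_algebra ::
  "('g, 'k::field) free_alg set \<Rightarrow> ('k, ('g, 'k) free_alg set) module" where
  "presented_algebra rels = quot_algebra free_algebra (genideal free_algebra rels)"

definition mat_algebra :: "nat \<Rightarrow> ('k, 'a) module \<Rightarrow> ('k, nat \<times> nat \<Rightarrow> 'a) module" where
  "mat_algebra n R = ring.extend
    \<lparr>carrier = ({..<n} \<times> {..<n}) \<rightarrow>\<^sub>E carrier R,
     monoid.mult = (\<lambda>M N. \<lambda>(i, j) \<in> {..<n} \<times> {..<n}. \<Oplus>\<^bsub>R\<^esub>k\<in>{..<n}. M (i, k) \<otimes>\<^bsub>R\<^esub> N (k, j)),
     monoid.one = (\<lambda>(i, j) \<in> {..<n} \<times> {..<n}. if i = j then \<one>\<^bsub>R\<^esub> else \<zero>\<^bsub>R\<^esub>),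
     ring.zero = (\<lambda>(i, j) \<in> {..<n} \<times> {..<n}. \<zero>\<^bsub>R\<^esub>),
     ring.add = (\<lambda>M N. \<lambda>(i, j) \<in> {..<n} \<times> {..<n}. M (i, j) \<oplus>\<^bsub>R\<^esub> N (i, j))\<rparr>
    (module.fields (\<lambda>c M. \<lambda>(i, j) \<in> {..<n} \<times> {..<n}. c \<odot>\<^bsub>R\<^esub> M (i, j)))"

definition direct_sum_algebra :: "('k, 'a) module list \<Rightarrow> ('k, 'a list) module" where
  "direct_sum_algebra As = ring.extend (RDirProd_list As)
     (module.fields (\<lambda>c. map2 (\<lambda>A a. c \<odot>\<^bsub>A\<^esub> a) As))"

definition alg_iso :: "('k, 'a) module \<Rightarrow> ('k, 'b) module \<Rightarrow> ('a \<Rightarrow> 'b) set" where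
  "alg_iso A B = {f \<in> ring_iso A B. \<forall>c. \<forall>a\<in>carrier A. f (c \<odot>\<^bsub>A\<^esub> a) = c \<odot>\<^bsub>B\<^esub> f a}"

definition local_cring :: "('a, 'm) ring_scheme \<Rightarrow> bool" where
  "local_cring R \<longleftrightarrow> cring R \<and> (\<exists>!I. maximalideal I R)"

section \<open>The direct summands\<close>

datatype gen = Gg | Gx | Gy

text \<open>
  The parameters \<open>b1\<close>, \<open>b2\<close> are the values of $x^n$ and $y^n$, and \<open>c\<close> is the constant subtracted
  from $g^{2n_1}$ in the last relation when \<open>b3\<close> is non-zero.
\<close>

definition summand_rels ::
  "nat \<Rightarrow> nat \<Rightarrow> 'k::field \<Rightarrow> 'k \<Rightarrow> 'k \<Rightarrow> 'k \<Rightarrow> 'k \<Rightarrow> (gen, 'k) free_alg set" where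
  "summand_rels n n1 q b1 b2 b3 c =
    (let g = var Gg; x = var Gx; y = var Gy in
      {g ^ n - 1,
       x ^ n - scal b1,
       y ^ n - scal b2,
       g * x - scal (inverse q) * x * g,
       g * y - scal q * y * g,
       (y * x - scal (q powi (- int n1)) * x * y)
         - (if b3 = 0 then 0 else g ^ (2 * n1) - scal c)})"

definition summand_algebra ::
  "nat \<Rightarrow> nat \<Rightarrow> 'k::field \<Rightarrow> 'k \<Rightarrow> 'k \<Rightarrow> 'k \<Rightarrow> 'k \<Rightarrow> ('k, (gen, 'k) free_alg set) module" where
  "summand_algebra n n1 q b1 b2 b3 c = presented_algebra (summand_rels n n1 q b1 b2 b3 c)"

end

theory Submission
  imports Defs
begin

text \<open>
  Suppose that \<open>x\<^sup>n\<close> is a nonzero scalar; the case of \<open>y\<^sup>n\<close> is symmetric. After rescaling, \<open>x\<^sup>n = 1\<close>, and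
  \<open>g\<close> and \<open>x\<close> satisfy the relations of the clock and shift matrices. Hence they provide a full system
  of \<open>n \<times> n\<close> matrix units in the algebra \<open>A\<close>: with \<open>e\<close> the average of the powers of \<open>g\<close>, these are
  the elements \<open>x\<^sup>i e x\<^sup>n\<^sup>-\<^sup>j\<close>. Therefore \<open>A\<close> is isomorphic to the algebra of \<open>n \<times> n\<close> matrices over the
  corner \<open>e A e\<close> (\<open>alg_iso_mat_corner\<close>, \<open>alg_iso_mat_corner_e\<close>).

  The corner is a commutative algebra with one generator: subtracting a suitable combination of
  \<open>g\<^sup>2\<^sup>l\<close> and \<open>1\<close> from \<open>y x\<close>, where \<open>l\<close> is the exponent \<open>n\<^sub>1\<close>, and multiplying by a power of \<open>g\<close> gives
  an element \<open>z\<close> commuting with \<open>g\<close> and \<open>x\<close> (\<open>exists_central_element\<close>), and \<open>A\<close> is generated by \<open>g\<close>,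
  \<open>x\<close> and \<open>z\<close>. It follows that \<open>e A e\<close> consists of the polynomials in \<open>z e\<close>, and the relation that \<open>y\<^sup>n\<close>
  is a scalar becomes an equation of degree \<open>n\<close> for \<open>z e\<close> (\<open>corner_polynomial\<close>).

  So \<open>e A e\<close> is a quotient of \<open>K[X]\<close> by a nonzero ideal. As \<open>K\<close> is algebraically closed, its unit is a
  sum of orthogonal idempotents \<open>f\<close> such that \<open>z f - l f\<close> is nilpotent for some scalar \<open>l\<close>, and the
  corners at these idempotents are local (\<open>local_decomposition\<close>). Matrix algebras respect this
  decomposition (\<open>alg_iso_mat_direct_sum\<close>).
\<close>

section \<open>Splitting idempotents of a monogenic algebra\<close>

lemma one_minus_power_dvd:
  fixes s :: "'a::comm_ring_1"
  shows "s dvd 1 - (1 - s) ^ m"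
proof (induction m)
  case (Suc m)
  have "1 - (1 - s) ^ Suc m = (1 - (1 - s) ^ m) + s * (1 - s) ^ m"
    by (simp add: algebra_simps)
  with Suc show ?case by (metis dvd_add dvd_triv_left)
qed simp

text \<open>
  For an ideal \<open>J\<close> of \<open>K[X]\<close> and an idempotent \<open>E\<close> modulo \<open>J\<close> with \<open>p * E\<close> in \<open>J\<close>, \<open>p \<noteq> 0\<close>,
  the idempotent is a sum of orthogonal idempotents, each killed modulo \<open>J\<close> by a power of a linear
  polynomial. If \<open>p = (X - l)\<^sup>m r\<close> with \<open>r(l) \<noteq> 0\<close>, normalise \<open>r\<close> to \<open>s\<close> with \<open>s(l) = 1\<close> and put
  \<open>u = (1 - s)\<^sup>m\<close>. Then \<open>(X - l)\<^sup>m\<close> divides \<open>u\<close> and \<open>r\<close> divides \<open>1 - u\<close>, so that \<open>E\<close> splits as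
  \<open>(1 - u) E + u E\<close>; the first part is killed by \<open>(X - l)\<^sup>m\<close> and the second one by \<open>r\<close>, which has
  smaller degree than \<open>p\<close>.
\<close>

lemma poly_idempotent_splitting:
  fixes J :: "'k::alg_closed_field poly set"
  assumes J0: "0 \<in> J" and Jadd: "\<And>s t. s \<in> J \<Longrightarrow> t \<in> J \<Longrightarrow> s + t \<in> J"
    and Jmult: "\<And>s t. s \<in> J \<Longrightarrow> t * s \<in> J"
    and "p \<noteq> 0" "E * E - E \<in> J" "p * E \<in> J"
  shows "\<exists>Fs. (\<forall>F\<in>set Fs. F * F - F \<in> J \<and> E * F - F \<in> J \<and> F \<notin> J
             \<and> (\<exists>l m. [:- l, 1:] ^ m * F \<in> J))
           \<and> sorted_wrt (\<lambda>F G. F * G \<in> J) Fs \<and> sum_list Fs - E \<in> J"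
  using assms(4-)
proof (induction "degree p" arbitrary: p E rule: less_induct)
  case less
  have Jdvd: "t \<in> J" if "s \<in> J" "s dvd t" for s t
    using that Jmult[of s] by (auto simp: dvd_def mult.commute)
  have Jdiff: "s - t \<in> J" if "s \<in> J" "t \<in> J" for s t
    using Jadd[OF that(1) Jmult[OF that(2), of "-1"]] by simp
  show ?case
  proof (cases "degree p = 0")
    case True
    then obtain c where p: "p = [:c:]" by (metis degree_eq_zeroE)
    with less.prems have "c \<noteq> 0" by simp
    have "[:inverse c:] * (p * E) = E" using \<open>c \<noteq> 0\<close> by (simp add: p)
    with Jmult[OF less.prems(3), of "[:inverse c:]"] have "E \<in> J" by simp
    with Jdiff[OF J0 this] show ?thesis by (intro exI[of _ "[]"]) simp
  next
    case False
    then obtain l where l: "poly p l = 0"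
      using alg_closed_imp_poly_has_root[of p] by auto
    define m where "m = order l p"
    have "[:-l, 1:] ^ m dvd p" unfolding m_def by (rule order_1)
    then obtain r where p: "p = [:-l, 1:] ^ m * r" by (auto simp: dvd_def)
    have r0: "r \<noteq> 0" using less.prems(1) p by auto
    have m0: "m \<noteq> 0" using l less.prems(1) by (simp add: m_def order_root)
    have "poly r l \<noteq> 0"
    proof
      assume "poly r l = 0"
      then obtain t where "r = [:-l, 1:] * t" by (auto simp: poly_eq_0_iff_dvd dvd_def)
      then have "p = [:-l, 1:] ^ Suc m * t" by (simp only: p power_Suc2 mult.assoc)
      then have "[:-l, 1:] ^ Suc m dvd p" by (rule dvdI)
      with order_2[OF less.prems(1), of l] show False by (simp add: m_def)
    qed
    define c where "c = inverse (poly r l)"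
    define s where "s = Polynomial.smult c r"
    define u where "u = (1 - s) ^ m"
    have "poly (1 - s) l = 0" using \<open>poly r l \<noteq> 0\<close> by (simp add: s_def c_def)
    then have "[:-l, 1:] dvd 1 - s" by (simp only: poly_eq_0_iff_dvd)
    then have u1: "[:-l, 1:] ^ m dvd u" unfolding u_def by (rule dvd_power_same)
    have "r dvd s" by (simp add: s_def dvd_smult)
    then have u2: "r dvd 1 - u" unfolding u_def using one_minus_power_dvd by (rule dvd_trans)
    have pu: "p dvd u * (1 - u)" unfolding p using u1 u2 by (rule mult_dvd_mono)
    have *: "u * (1 - u) * E \<in> J"
      using less.prems(3) mult_dvd_mono[OF pu dvd_refl] by (rule Jdvd)
    define F E' where "F = (1 - u) * E" and "E' = u * E"
    have EE: "t * (E * E - E) \<in> J" for t using less.prems(2) by (rule Jmult)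
    have "E' * E' - E' = (u * u) * (E * E - E) - u * (1 - u) * E"
      by (simp add: E'_def algebra_simps)
    then have E'E': "E' * E' - E' \<in> J" using Jdiff[OF EE *] by simp
    have "F * F - F = ((1 - u) * (1 - u)) * (E * E - E) - u * (1 - u) * E"
      by (simp add: F_def algebra_simps)
    then have FF: "F * F - F \<in> J" using Jdiff[OF EE *] by simp
    have "F * E' = (u * (1 - u)) * (E * E - E) + u * (1 - u) * E"
      by (simp add: F_def E'_def algebra_simps)
    then have FE': "F * E' \<in> J" using Jadd[OF EE *] by simp
    have "E * F - F = (1 - u) * (E * E - E)" by (simp add: F_def algebra_simps)
    then have EF: "E * F - F \<in> J" using EE by simp
    have "E * E' - E' = u * (E * E - E)" by (simp add: E'_def algebra_simps)
    then have EE': "E * E' - E' \<in> J" using EE by simp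
    have rE': "r * E' \<in> J"
    proof (rule Jdvd[OF less.prems(3)])
      show "p * E dvd r * E'" unfolding p E'_def
        using mult_dvd_mono[OF u1 dvd_refl[of "r * E"]] by (simp add: ac_simps)
    qed
    have lF: "[:-l, 1:] ^ m * F \<in> J"
    proof (rule Jdvd[OF less.prems(3)])
      show "p * E dvd [:-l, 1:] ^ m * F" unfolding p F_def
        using mult_dvd_mono[OF u2 dvd_refl[of "[:-l, 1:] ^ m * E"]] by (simp add: ac_simps)
    qed
    have "degree p = m + degree r"
      using r0 by (simp add: p degree_mult_eq degree_power_eq)
    with m0 have "degree r < degree p" by simp
    from less.hyps[OF this r0 E'E' rE'] obtain Fs where
      Fs: "\<And>G. G \<in> set Fs \<Longrightarrow> G * G - G \<in> J \<and> E' * G - G \<in> J \<and> G \<notin> J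
             \<and> (\<exists>l m. [:- l, 1:] ^ m * G \<in> J)"
      and orth: "sorted_wrt (\<lambda>F G. F * G \<in> J) Fs" and sum: "sum_list Fs - E' \<in> J"
      by blast
    have EG: "E * G - G \<in> J" if "G \<in> set Fs" for G
    proof -
      have "E * G - G = (E' * G - G) - E * (E' * G - G) + G * (E * E' - E')"
        by (simp add: algebra_simps)
      also have "\<dots> \<in> J" using Fs[OF that] EE' by (meson Jadd Jdiff Jmult)
      finally show ?thesis .
    qed
    have FG: "F * G \<in> J" if "G \<in> set Fs" for G
    proof -
      have "F * G = G * (F * E') - F * (E' * G - G)" by (simp add: algebra_simps)
      also have "\<dots> \<in> J" using Fs[OF that] FE' by (meson Jdiff Jmult)
      finally show ?thesis .
    qed
    show ?thesis
    proof (cases "F \<in> J")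
      case True
      have "sum_list Fs - E = (sum_list Fs - E') - F" by (simp add: F_def E'_def algebra_simps)
      then have "sum_list Fs - E \<in> J" using Jdiff[OF sum True] by (simp only:)
      with Fs EG orth show ?thesis by (intro exI[of _ Fs]) auto
    next
      case False
      have "sum_list (F # Fs) - E = sum_list Fs - E'" by (simp add: F_def E'_def algebra_simps)
      with sum have "sum_list (F # Fs) - E \<in> J" by (simp only:)
      with Fs EG FG orth FF EF lF False show ?thesis
        by (intro exI[of _ "F # Fs"]) auto
    qed
  qed
qed

section \<open>Associative algebras, corners and polynomial evaluation\<close>

text \<open>
  A unital, not necessarily commutative, associative algebra over the field \<open>'k\<close>. Scalars are taken
  from a type, so the module axioms are stated with the type class operations.
\<close>

locale assoc_algebra = ring A for A :: "('k::field, 'a) module" (structure) +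
  assumes smult_closed [simp, intro]: "a \<in> carrier A \<Longrightarrow> c \<odot> a \<in> carrier A"
    and smult_l_distr: "a \<in> carrier A \<Longrightarrow> (c + d) \<odot> a = c \<odot> a \<oplus> d \<odot> a"
    and smult_r_distr: "a \<in> carrier A \<Longrightarrow> b \<in> carrier A \<Longrightarrow> c \<odot> (a \<oplus> b) = c \<odot> a \<oplus> c \<odot> b"
    and smult_smult [simp]: "a \<in> carrier A \<Longrightarrow> c \<odot> (d \<odot> a) = (c * d) \<odot> a"
    and smult_one [simp]: "a \<in> carrier A \<Longrightarrow> 1 \<odot> a = a"
    and smult_mult_left [simp]:
      "a \<in> carrier A \<Longrightarrow> b \<in> carrier A \<Longrightarrow> (c \<odot> a) \<otimes> b = c \<odot> (a \<otimes> b)"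
    and smult_mult_right [simp]:
      "a \<in> carrier A \<Longrightarrow> b \<in> carrier A \<Longrightarrow> a \<otimes> (c \<odot> b) = c \<odot> (a \<otimes> b)"
begin

lemma smult_0 [simp]: "a \<in> carrier A \<Longrightarrow> 0 \<odot> a = \<zero>"
  using smult_l_distr[of a 0 0] by (simp add: add.l_cancel_one')

lemma smult_zero [simp]: "c \<odot> \<zero> = \<zero>"
  using smult_r_distr[of \<zero> \<zero> c] by (simp add: add.l_cancel_one')

lemma smult_uminus: "a \<in> carrier A \<Longrightarrow> (- c) \<odot> a = \<ominus> (c \<odot> a)"
  using smult_l_distr[of a "- c" c] by (simp add: minus_equality)

lemma smult_cancel:
  assumes "a \<in> carrier A" "c \<odot> a = \<zero>" "c \<noteq> 0"
  shows "a = \<zero>"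
  using assms smult_smult[of a "inverse c" c] by simp

lemma algebra_of_commutative:
  assumes "\<And>a b. a \<in> carrier A \<Longrightarrow> b \<in> carrier A \<Longrightarrow> a \<otimes> b = b \<otimes> a"
  shows "cring A" "algebra (ring_of_type_algebra :: 'k ring) A"
proof -
  show *: "cring A" by unfold_locales (auto simp: assms)
  show "algebra (ring_of_type_algebra :: 'k ring) A"
    by (rule algebraI[OF cring_from_type_algebra *])
       (auto simp: ring_of_type_algebra_def smult_l_distr smult_r_distr)
qed

end

text \<open>
  The corner algebra \<open>e A e\<close> of an idempotent \<open>e\<close>, with unit \<open>e\<close>. Its carrier is a subset of that of
  \<open>A\<close>; membership is expressed by the equations \<open>e a = a = a e\<close>.
\<close>

definition corner :: "('k, 'a) module \<Rightarrow> 'a \<Rightarrow> ('k, 'a) module" where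
  "corner A e = A\<lparr>carrier := {a \<in> carrier A. e \<otimes>\<^bsub>A\<^esub> a = a \<and> a \<otimes>\<^bsub>A\<^esub> e = a}, one := e\<rparr>"

lemma corner_simps [simp]:
  "carrier (corner A e) = {a \<in> carrier A. e \<otimes>\<^bsub>A\<^esub> a = a \<and> a \<otimes>\<^bsub>A\<^esub> e = a}"
  "monoid.mult (corner A e) = monoid.mult A" "monoid.one (corner A e) = e" "ring.zero (corner A e) = ring.zero A"
  "ring.add (corner A e) = ring.add A" "module.smult (corner A e) = module.smult A"
  by (simp_all add: corner_def)

lemma (in assoc_algebra) corner_algebra:
  assumes e: "e \<in> carrier A" "e \<otimes> e = e"
  shows "assoc_algebra (corner A e)"
proof -
  have "abelian_group (corner A e)"
  proof (rule abelian_groupI)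
    fix x assume "x \<in> carrier (corner A e)"
    then show "\<exists>y\<in>carrier (corner A e). y \<oplus>\<^bsub>corner A e\<^esub> x = \<zero>\<^bsub>corner A e\<^esub>"
      using e by (intro bexI[of _ "\<ominus> x"]) (auto simp: l_neg r_minus l_minus)
  qed (use e in \<open>auto simp: r_distr l_distr a_ac\<close>)
  moreover have "monoid (corner A e)"
  proof (rule monoidI)
    fix x y assume "x \<in> carrier (corner A e)" "y \<in> carrier (corner A e)"
    then show "x \<otimes>\<^bsub>corner A e\<^esub> y \<in> carrier (corner A e)"
      using e by (auto simp: m_assoc) (metis m_assoc)
  qed (use e in \<open>auto simp: m_assoc\<close>)
  ultimately have "ring (corner A e)"
    by (rule ringI) (auto simp: l_distr r_distr)
  then interpret B: ring "corner A e" .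
  show ?thesis
    using e by unfold_locales (auto simp: smult_l_distr smult_r_distr)
qed

lemma (in assoc_algebra) corner_finsum:
  assumes e: "e \<in> carrier A" "e \<otimes> e = e" and f: "f \<in> I \<rightarrow> carrier (corner A e)"
  shows "finsum (corner A e) f I = finsum A f I"
proof -
  interpret B: assoc_algebra "corner A e" by (rule corner_algebra[OF e])
  show ?thesis using f
  proof (induction I rule: infinite_finite_induct)
    case (infinite I)
    then show ?case by (simp add: finsum_infinite B.finsum_infinite)
  next
    case (insert i I)
    then have 1: "f \<in> I \<rightarrow> carrier (corner A e)" "f i \<in> carrier (corner A e)" by auto
    then have 2: "f \<in> I \<rightarrow> carrier A" "f i \<in> carrier A" by auto
    show ?case
      using insert.hyps insert.IH[OF 1(1)]
      by (simp only: B.finsum_insert[OF insert.hyps 1] finsum_insert[OF insert.hyps 2]) simp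
  qed simp
qed

text \<open>
  Evaluation of a polynomial at an element of an algebra, by Horner's rule.
\<close>

definition poly_ev :: "('k::field, 'a) module \<Rightarrow> 'a \<Rightarrow> 'k poly \<Rightarrow> 'a" where
  "poly_ev A z p = fold_coeffs (\<lambda>c a. c \<odot>\<^bsub>A\<^esub> \<one>\<^bsub>A\<^esub> \<oplus>\<^bsub>A\<^esub> z \<otimes>\<^bsub>A\<^esub> a) p \<zero>\<^bsub>A\<^esub>"

context assoc_algebra
begin

context
  fixes z assumes z [simp]: "z \<in> carrier A"
begin

lemma ev_0 [simp]: "poly_ev A z 0 = \<zero>"
  by (simp add: poly_ev_def)

lemma ev_pCons: "poly_ev A z (pCons c p) = c \<odot> \<one> \<oplus> z \<otimes> poly_ev A z p"
  by (cases "p = 0 \<and> c = 0") (auto simp: poly_ev_def)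

lemma ev_closed [simp]: "poly_ev A z p \<in> carrier A"
  by (induction p) (auto simp: ev_pCons)

lemma ev_add: "poly_ev A z (p + r) = poly_ev A z p \<oplus> poly_ev A z r"
  by (induction p r rule: poly_induct2) (auto simp: ev_pCons smult_l_distr r_distr a_ac)

lemma ev_smult: "poly_ev A z (Polynomial.smult c p) = c \<odot> poly_ev A z p"
  by (induction p) (auto simp: ev_pCons smult_r_distr)

lemma ev_mult: "poly_ev A z (p * r) = poly_ev A z p \<otimes> poly_ev A z r"
  by (induction p) (auto simp: ev_pCons ev_add ev_smult l_distr m_assoc)

lemma ev_const [simp]: "poly_ev A z [:c:] = c \<odot> \<one>"
  by (simp add: ev_pCons)

lemma ev_1 [simp]: "poly_ev A z 1 = \<one>"
  by (simp add: one_pCons)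

lemma ev_diff: "poly_ev A z (p - r) = poly_ev A z p \<ominus> poly_ev A z r"
  using ev_add[of p "- r"] ev_smult[of "- 1" r] by (simp add: smult_uminus minus_eq)

lemma ev_commute: "poly_ev A z p \<otimes> poly_ev A z r = poly_ev A z r \<otimes> poly_ev A z p"
  by (metis ev_mult mult.commute)

lemma ev_sum_list: "poly_ev A z (sum_list ps) = (\<Oplus>i\<in>{..<length ps}. poly_ev A z (ps ! i))"
proof (induction ps)
  case (Cons p ps)
  have "{..<length (p # ps)} = insert 0 (Suc ` {..<length ps})"
    by (auto simp: lessThan_Suc_eq_insert_0)
  moreover have "(\<Oplus>i\<in>Suc ` {..<length ps}. poly_ev A z ((p # ps) ! i))
      = (\<Oplus>i\<in>{..<length ps}. poly_ev A z (ps ! i))"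
    by (subst finsum_reindex) (auto simp: inj_on_def)
  ultimately show ?case using Cons by (simp add: ev_add)
qed simp

lemma ev_corner:
  assumes "f \<in> carrier A" "f \<otimes> f = f" "f = poly_ev A z F"
  shows "poly_ev (corner A f) (z \<otimes> f) h = poly_ev A z h \<otimes> f"
proof -
  have zf: "z \<otimes> f = f \<otimes> z" using ev_commute[of "[:0, 1:]" F] assms by (simp add: ev_pCons)
  then have "z \<otimes> f \<in> carrier (corner A f)"
    using assms by (auto simp: m_assoc) (metis assms(1) m_assoc z)
  interpret B: assoc_algebra "corner A f" by (rule corner_algebra) (use assms in auto)
  have hf: "f \<otimes> poly_ev A z h = poly_ev A z h \<otimes> f" for h using ev_commute assms by metis
  show ?thesis
  proof (induction h)
    case (pCons c h)
    have "(z \<otimes> f) \<otimes> (poly_ev A z h \<otimes> f) = (z \<otimes> poly_ev A z h) \<otimes> f"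
      using assms(1,2) hf[of h] by (simp add: m_assoc) (metis assms(1,2) ev_closed hf m_assoc)
    then show ?case
      using pCons assms(1) \<open>z \<otimes> f \<in> carrier (corner A f)\<close>
      by (subst B.ev_pCons) (auto simp: ev_pCons l_distr)
  qed (use assms(1) in \<open>simp add: poly_ev_def\<close>)
qed

end
end

section \<open>Decomposition into local algebras\<close>

lemma (in cring) local_cringI:
  assumes M: "ideal M R" "M \<noteq> carrier R"
    and units: "\<And>a. a \<in> carrier R \<Longrightarrow> a \<notin> M \<Longrightarrow> \<exists>b\<in>carrier R. b \<otimes> a = \<one>"
  shows "local_cring R"
proof -
  have full: "I = carrier R" if I: "ideal I R" and "\<not> I \<subseteq> M" for I
  proof -
    from that obtain a where a: "a \<in> I" "a \<notin> M" by auto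
    interpret I: ideal I R by fact
    obtain b where "b \<in> carrier R" "b \<otimes> a = \<one>" using units a I.a_Hcarr by blast
    then have "\<one> \<in> I" using I.I_l_closed[OF a(1)] by metis
    then show ?thesis by (rule I.one_imp_carrier)
  qed
  have "maximalideal M R"
    using M full by (intro maximalidealI) auto
  moreover have "I = M" if I: "maximalideal I R" for I
  proof -
    interpret I: maximalideal I R by fact
    have "I \<subseteq> M" using full[OF I.is_ideal] I.I_notcarr by auto
    moreover have "M \<subseteq> carrier R" using M(1) by (meson additive_subgroup.a_subset ideal.axioms(1))
    ultimately show ?thesis using I.I_maximal[OF M(1)] M(2) by auto
  qed
  ultimately show ?thesis unfolding local_cring_def using is_cring by blast
qed

text \<open>
  The maximal ideal consists of the values of the polynomials vanishing at \<open>l\<close>. These are nilpotent,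
  and the trick of \<open>one_minus_power_dvd\<close> inverts every other element.
\<close>

lemma (in assoc_algebra) local_of_nilpotent_generator:
  assumes z: "z \<in> carrier A" and gen: "carrier A = range (poly_ev A z)"
    and nil: "poly_ev A z ([:- l, 1:] ^ m) = \<zero>" and "\<one> \<noteq> \<zero>"
  shows "local_cring A"
proof -
  have comm: "a \<otimes> b = b \<otimes> a" if "a \<in> carrier A" "b \<in> carrier A" for a b
    using that ev_commute[OF z] by (auto simp: gen)
  interpret C: cring A using comm by (rule algebra_of_commutative)
  note ev = ev_0[OF z] ev_add[OF z] ev_mult[OF z] ev_1[OF z] ev_closed[OF z] ev_diff[OF z] ev_smult[OF z]
  have kill: "poly_ev A z (h ^ m) = \<zero>" if "poly h l = 0" for h
  proof -
    obtain k where "h = [:-l, 1:] * k" using \<open>poly h l = 0\<close> by (auto simp: poly_eq_0_iff_dvd dvd_def)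
    then show ?thesis using nil by (simp only: power_mult_distrib ev l_null)
  qed
  define M where "M = poly_ev A z ` {h. poly h l = 0}"
  have "ideal M A"
  proof (rule idealI[OF ring_axioms])
    show "subgroup M (add_monoid A)"
    proof
      show "M \<subseteq> carrier (add_monoid A)" by (auto simp: M_def ev)
      show "\<one>\<^bsub>add_monoid A\<^esub> \<in> M" unfolding M_def using ev(1) by (auto intro!: image_eqI[of _ _ 0])
      show "a \<otimes>\<^bsub>add_monoid A\<^esub> b \<in> M" if "a \<in> M" "b \<in> M" for a b
      proof -
        obtain h k where "poly h l = 0" "a = poly_ev A z h" "poly k l = 0" "b = poly_ev A z k"
          using \<open>a \<in> M\<close> \<open>b \<in> M\<close> unfolding M_def by blast
        then have "poly (h + k) l = 0" "a \<oplus> b = poly_ev A z (h + k)" by (simp_all add: ev)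
        then show ?thesis unfolding M_def by auto
      qed
      show "inv\<^bsub>add_monoid A\<^esub> a \<in> M" if "a \<in> M" for a
      proof -
        obtain h where h: "poly h l = 0" "a = poly_ev A z h"
          using \<open>a \<in> M\<close> unfolding M_def by blast
        then have "\<ominus> a = poly_ev A z (Polynomial.smult (-1) h)"
          by (simp only: ev smult_uminus smult_one)
        moreover have "poly (Polynomial.smult (-1) h) l = 0" using h by simp
        ultimately show ?thesis unfolding M_def a_inv_def[symmetric] by blast
      qed
    qed
    show *: "b \<otimes> a \<in> M" if "a \<in> M" "b \<in> carrier A" for a b
    proof -
      obtain h k where "poly h l = 0" "a = poly_ev A z h" "b = poly_ev A z k"
        using \<open>a \<in> M\<close> \<open>b \<in> carrier A\<close> unfolding M_def gen by blast
      then have "poly (k * h) l = 0" "b \<otimes> a = poly_ev A z (k * h)" by (simp_all add: ev)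
      then show ?thesis unfolding M_def by blast
    qed
    show "a \<otimes> b \<in> M" if "a \<in> M" "b \<in> carrier A" for a b
    proof -
      have "a \<in> carrier A" using \<open>a \<in> M\<close> by (auto simp: M_def ev)
      then show ?thesis using *[OF that] comm[OF _ that(2)] by simp
    qed
  qed
  moreover have "M \<noteq> carrier A"
  proof
    assume "M = carrier A"
    with one_closed have "\<one> \<in> M" by simp
    then obtain h where h: "poly h l = 0" "\<one> = poly_ev A z h" unfolding M_def by blast
    have "poly_ev A z (h ^ k) = \<one>" for k by (induction k) (simp_all add: ev h(2)[symmetric])
    with kill[OF h(1)] \<open>\<one> \<noteq> \<zero>\<close> show False by simp
  qed
  moreover have "\<exists>b\<in>carrier A. b \<otimes> a = \<one>" if "a \<in> carrier A" "a \<notin> M" for a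
  proof -
    obtain h where h: "a = poly_ev A z h" "poly h l \<noteq> 0"
      using \<open>a \<in> carrier A\<close> \<open>a \<notin> M\<close> unfolding M_def gen by blast
    define s where "s = Polynomial.smult (inverse (poly h l)) h"
    have "poly (1 - s) l = 0" using h by (simp add: s_def)
    then have *: "poly_ev A z (1 - (1 - s) ^ m) = \<one>" using kill by (simp add: ev minus_eq)
    have "h dvd s" by (simp add: s_def dvd_smult)
    then have "h dvd 1 - (1 - s) ^ m" using one_minus_power_dvd by (rule dvd_trans)
    then obtain k where "1 - (1 - s) ^ m = k * h" by (auto simp: dvd_def mult.commute)
    with * h have "poly_ev A z k \<otimes> a = \<one>" by (simp only: ev)
    then show ?thesis using ev by blast
  qed
  ultimately show ?thesis by (rule C.local_cringI)
qed

lemma local_decomposition: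
  fixes A :: "('k::alg_closed_field, 'a) module" (structure)
  assumes "assoc_algebra A" and z: "z \<in> carrier A" and gen: "carrier A = range (poly_ev A z)"
    and p: "p \<noteq> 0" "poly_ev A z p = \<zero>"
  shows "\<exists>fs. (\<forall>f\<in>set fs. f \<in> carrier A \<and> f \<otimes> f = f \<and> local_cring (corner A f))
           \<and> (\<forall>i<length fs. \<forall>j<length fs. i \<noteq> j \<longrightarrow> fs ! i \<otimes> fs ! j = \<zero>)
           \<and> (\<Oplus>i\<in>{..<length fs}. fs ! i) = \<one>"
proof -
  interpret assoc_algebra A by fact
  note ev = ev_0[OF z] ev_add[OF z] ev_mult[OF z] ev_1[OF z] ev_closed[OF z] ev_diff[OF z]
  define J where "J = {s. poly_ev A z s = \<zero>}"
  have J_diff: "poly_ev A z s = poly_ev A z t" if "s - t \<in> J" for s t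
    using that by (simp add: J_def ev)
  have "\<exists>Fs. (\<forall>F\<in>set Fs. F * F - F \<in> J \<and> 1 * F - F \<in> J \<and> F \<notin> J
             \<and> (\<exists>l m. [:- l, 1:] ^ m * F \<in> J))
           \<and> sorted_wrt (\<lambda>F G. F * G \<in> J) Fs \<and> sum_list Fs - 1 \<in> J"
    using p by (intro poly_idempotent_splitting[where p = p]) (auto simp: J_def ev)
  then obtain Fs where
    Fs: "\<And>F. F \<in> set Fs \<Longrightarrow> F * F - F \<in> J \<and> F \<notin> J \<and> (\<exists>l m. [:- l, 1:] ^ m * F \<in> J)"
    and orth: "sorted_wrt (\<lambda>F G. F * G \<in> J) Fs" and sum: "sum_list Fs - 1 \<in> J"
    by blast
  define fs where "fs = map (poly_ev A z) Fs"
  have "f \<in> carrier A \<and> f \<otimes> f = f \<and> local_cring (corner A f)" if "f \<in> set fs" for f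
  proof -
    from that obtain F where F: "F \<in> set Fs" and f: "f = poly_ev A z F" by (auto simp: fs_def)
    have fc: "f \<in> carrier A" by (simp add: f ev)
    from Fs[OF F] obtain l m where FF: "F * F - F \<in> J" and F0: "F \<notin> J"
      and nil: "[:- l, 1:] ^ m * F \<in> J" by blast
    have ff: "f \<otimes> f = f" using J_diff[OF FF] by (simp add: ev f)
    note evc = ev_corner[OF z fc ff f]
    interpret B: assoc_algebra "corner A f" by (rule corner_algebra[OF fc ff])
    have fev: "f \<otimes> poly_ev A z h = poly_ev A z h \<otimes> f" for h
      unfolding f by (rule ev_commute[OF z])
    have "local_cring (corner A f)"
    proof (rule B.local_of_nilpotent_generator)
      have "z = poly_ev A z [:0, 1:]" using z by (simp add: ev_pCons)
      then have "f \<otimes> z = z \<otimes> f" using fev by metis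
      then show "z \<otimes> f \<in> carrier (corner A f)"
        using z fc ff by (auto simp: m_assoc) (metis fc ff m_assoc z)
      show "carrier (corner A f) = range (poly_ev (corner A f) (z \<otimes> f))"
      proof (intro equalityI subsetI)
        fix a assume "a \<in> carrier (corner A f)"
        then have "a \<in> carrier A" "a = a \<otimes> f" by auto
        then obtain h where "a = poly_ev A z h \<otimes> f" using gen by auto
        then show "a \<in> range (poly_ev (corner A f) (z \<otimes> f))" unfolding evc[symmetric] by blast
      next
        fix a assume "a \<in> range (poly_ev (corner A f) (z \<otimes> f))"
        then obtain h where h: "a = poly_ev A z h \<otimes> f" unfolding evc by blast
        then have "f \<otimes> a = a"
          using fc ff fev[of h] by (metis ev(5) m_assoc)
        then show "a \<in> carrier (corner A f)" using fc ff h ev(5) by (simp add: m_assoc)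
      qed
      show "poly_ev (corner A f) (z \<otimes> f) ([:- l, 1:] ^ m) = \<zero>\<^bsub>corner A f\<^esub>"
        using nil unfolding evc by (simp add: f ev J_def)
      show "\<one>\<^bsub>corner A f\<^esub> \<noteq> \<zero>\<^bsub>corner A f\<^esub>" using F0 by (simp add: J_def f)
    qed
    with fc ff show ?thesis by blast
  qed
  moreover have "fs ! i \<otimes> fs ! j = \<zero>" if "i < length fs" "j < length fs" "i \<noteq> j" for i j
  proof -
    have "Fs ! i * Fs ! j \<in> J" if "i < j" "j < length fs" for i j
      using orth that by (simp add: sorted_wrt_iff_nth_less fs_def)
    then have "Fs ! i * Fs ! j \<in> J"
      using that by (metis linorder_neqE_nat mult.commute)
    then show ?thesis using that by (simp add: fs_def J_def ev)
  qed
  moreover have "(\<Oplus>i\<in>{..<length fs}. fs ! i) = \<one>"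
  proof -
    have "(\<Oplus>i\<in>{..<length fs}. fs ! i) = poly_ev A z (sum_list Fs)"
      unfolding ev_sum_list[OF z] by (rule finsum_cong') (auto simp: fs_def ev)
    then show ?thesis using J_diff[OF sum] by (simp add: ev)
  qed
  ultimately show ?thesis by (intro exI[of _ fs]) blast
qed

section \<open>Matrix algebras and direct sums\<close>

lemma mat_algebra_simps:
  "carrier (mat_algebra n R) = ({..<n} \<times> {..<n}) \<rightarrow>\<^sub>E carrier R"
  "M \<otimes>\<^bsub>mat_algebra n R\<^esub> N
     = (\<lambda>(i, j) \<in> {..<n} \<times> {..<n}. \<Oplus>\<^bsub>R\<^esub>k\<in>{..<n}. M (i, k) \<otimes>\<^bsub>R\<^esub> N (k, j))"
  "\<one>\<^bsub>mat_algebra n R\<^esub> = (\<lambda>(i, j) \<in> {..<n} \<times> {..<n}. if i = j then \<one>\<^bsub>R\<^esub> else \<zero>\<^bsub>R\<^esub>)"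
  "M \<oplus>\<^bsub>mat_algebra n R\<^esub> N = (\<lambda>(i, j) \<in> {..<n} \<times> {..<n}. M (i, j) \<oplus>\<^bsub>R\<^esub> N (i, j))"
  "c \<odot>\<^bsub>mat_algebra n R\<^esub> M = (\<lambda>(i, j) \<in> {..<n} \<times> {..<n}. c \<odot>\<^bsub>R\<^esub> M (i, j))"
  by (simp_all add: mat_algebra_def ring.defs module.defs)

lemma matrix_eqI:
  assumes "\<And>i j. i < n \<Longrightarrow> j < n \<Longrightarrow> F i j = G i j"
  shows "(\<lambda>(i, j) \<in> {..<n} \<times> {..<n}. F i j) = (\<lambda>(i, j) \<in> {..<n::nat} \<times> {..<n::nat}. G i j)"
  using assms by (auto intro!: restrict_ext)

lemma mat_algebra_carrierI:
  assumes "\<And>i j. i < n \<Longrightarrow> j < n \<Longrightarrow> F i j \<in> carrier R"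
  shows "(\<lambda>(i, j) \<in> {..<n} \<times> {..<n}. F i j) \<in> carrier (mat_algebra n R)"
  using assms by (auto simp: mat_algebra_simps(1))

text \<open>
  The elements \<open>u\<^sub>i v\<^sub>j\<close> form a system of matrix units, and \<open>a\<close> has the entries \<open>v\<^sub>i a u\<^sub>j\<close>.
\<close>

lemma (in assoc_algebra) alg_iso_mat_corner:
  assumes e: "e \<in> carrier A" "e \<otimes> e = e"
    and u: "\<And>i. i < n \<Longrightarrow> u i \<in> carrier A" "\<And>i. i < n \<Longrightarrow> u i \<otimes> e = u i"
    and v: "\<And>i. i < n \<Longrightarrow> v i \<in> carrier A" "\<And>i. i < n \<Longrightarrow> e \<otimes> v i = v i"
    and vu: "\<And>i j. i < n \<Longrightarrow> j < n \<Longrightarrow> v i \<otimes> u j = (if i = j then e else \<zero>)"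
    and sum: "(\<Oplus>i\<in>{..<n}. u i \<otimes> v i) = \<one>"
  shows "(\<lambda>a. \<lambda>(i, j)\<in>{..<n} \<times> {..<n}. v i \<otimes> a \<otimes> u j) \<in> alg_iso A (mat_algebra n (corner A e))"
    (is "?f \<in> _")
proof -
  note [simp] = u(1) v(1) e(1)
  have cc: "v i \<otimes> a \<otimes> u j \<in> carrier (corner A e)" if "a \<in> carrier A" "i < n" "j < n" for a i j
  proof -
    have "e \<otimes> (v i \<otimes> (a \<otimes> u j)) = v i \<otimes> (a \<otimes> u j)"
      using that by (simp add: m_assoc[symmetric] v(2))
    then show ?thesis using that by (simp add: m_assoc u(2))
  qed
  have fc: "?f a \<in> carrier (mat_algebra n (corner A e))" if "a \<in> carrier A" for a
    using cc[OF that] by (intro mat_algebra_carrierI) blast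
  have insert_one: "a \<otimes> (\<Oplus>k\<in>{..<n}. u k \<otimes> v k) \<otimes> b = a \<otimes> b"
    if "a \<in> carrier A" "b \<in> carrier A" for a b
    using that by (simp add: sum)
  have mult: "?f (a \<otimes> b) = ?f a \<otimes>\<^bsub>mat_algebra n (corner A e)\<^esub> ?f b"
    if ab: "a \<in> carrier A" "b \<in> carrier A" for a b
    unfolding mat_algebra_simps
  proof (rule matrix_eqI)
    fix i j assume ij: "i < n" "j < n"
    have "(\<Oplus>\<^bsub>corner A e\<^esub>k\<in>{..<n}. ?f a (i, k) \<otimes>\<^bsub>corner A e\<^esub> ?f b (k, j))
        = (\<Oplus>\<^bsub>corner A e\<^esub>k\<in>{..<n}. (v i \<otimes> a \<otimes> u k) \<otimes>\<^bsub>corner A e\<^esub> (v k \<otimes> b \<otimes> u j))"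
    proof -
      interpret B: assoc_algebra "corner A e" by (rule corner_algebra[OF e])
      show ?thesis
        by (rule B.finsum_cong') (use cc ij ab B.m_closed in \<open>auto simp del: corner_simps\<close>)
    qed
    also have "\<dots> = (\<Oplus>k\<in>{..<n}. (v i \<otimes> a \<otimes> u k) \<otimes> (v k \<otimes> b \<otimes> u j))"
    proof (subst corner_finsum[OF e])
      interpret B: assoc_algebra "corner A e" by (rule corner_algebra[OF e])
      show "(\<lambda>k. (v i \<otimes> a \<otimes> u k) \<otimes>\<^bsub>corner A e\<^esub> (v k \<otimes> b \<otimes> u j)) \<in> {..<n} \<rightarrow> carrier (corner A e)"
        using cc ij ab B.m_closed by (auto simp del: corner_simps)
    qed simp
    also have "\<dots> = (\<Oplus>k\<in>{..<n}. (v i \<otimes> a) \<otimes> (u k \<otimes> v k) \<otimes> (b \<otimes> u j))"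
      using ij ab by (intro finsum_cong') (auto simp: m_assoc)
    also have "\<dots> = (v i \<otimes> a) \<otimes> (\<Oplus>k\<in>{..<n}. u k \<otimes> v k) \<otimes> (b \<otimes> u j)"
      using ij ab by (simp add: finsum_ldistr finsum_rdistr Pi_def)
    also have "\<dots> = v i \<otimes> (a \<otimes> b) \<otimes> u j"
      using ij ab by (subst insert_one) (auto simp: m_assoc)
    finally show "v i \<otimes> (a \<otimes> b) \<otimes> u j
        = (\<Oplus>\<^bsub>corner A e\<^esub>k\<in>{..<n}. ?f a (i, k) \<otimes>\<^bsub>corner A e\<^esub> ?f b (k, j))" by simp
  qed
  have hom: "?f \<in> ring_hom A (mat_algebra n (corner A e))"
  proof (rule ring_hom_memI)
    show "?f (a \<oplus> b) = ?f a \<oplus>\<^bsub>mat_algebra n (corner A e)\<^esub> ?f b"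
      if "a \<in> carrier A" "b \<in> carrier A" for a b
      unfolding mat_algebra_simps using that
      by (intro matrix_eqI) (auto simp: l_distr r_distr)
    show "?f \<one> = \<one>\<^bsub>mat_algebra n (corner A e)\<^esub>"
      unfolding mat_algebra_simps by (intro matrix_eqI) (auto simp: vu)
  qed (use fc mult in auto)
  define g where "g M = (\<Oplus>i\<in>{..<n}. \<Oplus>j\<in>{..<n}. u i \<otimes> M (i, j) \<otimes> v j)" for M
  have Mc: "M (i, j) \<in> carrier A" "e \<otimes> M (i, j) = M (i, j)" "M (i, j) \<otimes> e = M (i, j)"
    if "M \<in> carrier (mat_algebra n (corner A e))" "i < n" "j < n" for M i j
    using that PiE_mem[of M "{..<n} \<times> {..<n}" _ "(i, j)"] by (auto simp: mat_algebra_simps)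
  have "bij_betw ?f (carrier A) (carrier (mat_algebra n (corner A e)))"
  proof (rule bij_betwI[where g = g])
    show "?f \<in> carrier A \<rightarrow> carrier (mat_algebra n (corner A e))" using fc by blast
    show "g \<in> carrier (mat_algebra n (corner A e)) \<rightarrow> carrier A"
      unfolding g_def using Mc by (auto intro!: finsum_closed)
    show "g (?f a) = a" if a: "a \<in> carrier A" for a
    proof -
      have "g (?f a) = (\<Oplus>i\<in>{..<n}. \<Oplus>j\<in>{..<n}. (u i \<otimes> v i) \<otimes> a \<otimes> (u j \<otimes> v j))"
        unfolding g_def using a by (intro finsum_cong') (auto simp: m_assoc intro!: finsum_cong')
      also have "\<dots> = (\<Oplus>i\<in>{..<n}. u i \<otimes> v i) \<otimes> a \<otimes> (\<Oplus>j\<in>{..<n}. u j \<otimes> v j)"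
        using a by (subst finsum_ldistr, simp, simp, simp add: Pi_def)+
          (intro finsum_cong'; simp add: finsum_rdistr Pi_def)+
      finally show ?thesis using a by (simp add: sum)
    qed
    show "?f (g M) = M" if M: "M \<in> carrier (mat_algebra n (corner A e))" for M
    proof (rule extensionalityI[where A = "{..<n} \<times> {..<n}"])
      show "?f (g M) \<in> extensional ({..<n} \<times> {..<n})" by simp
      show "M \<in> extensional ({..<n} \<times> {..<n})" using M by (simp add: mat_algebra_simps PiE_def)
      fix p :: "nat \<times> nat" assume "p \<in> {..<n} \<times> {..<n}"
      then obtain k l where p: "p = (k, l)" and kl: "k < n" "l < n" by auto
      note [simp] = Mc[OF M]
      have inner: "v k \<otimes> (\<Oplus>j\<in>{..<n}. u i \<otimes> M (i, j) \<otimes> v j) \<otimes> u l = (if k = i then M (i, l) else \<zero>)"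
        if i: "i < n" for i
      proof -
        have "v k \<otimes> (\<Oplus>j\<in>{..<n}. u i \<otimes> M (i, j) \<otimes> v j) \<otimes> u l
            = (\<Oplus>j\<in>{..<n}. (v k \<otimes> u i) \<otimes> M (i, j) \<otimes> (v j \<otimes> u l))"
          using i kl by (simp add: finsum_ldistr finsum_rdistr Pi_def m_assoc cong: finsum_cong)
        also have "\<dots> = (\<Oplus>j\<in>{..<n}. if l = j then (if k = i then M (i, j) else \<zero>) else \<zero>)"
          using i kl by (intro finsum_cong') (auto simp: vu)
        also have "\<dots> = (if k = i then M (i, l) else \<zero>)"
          using i kl by (subst add.finprod_singleton) auto
        finally show ?thesis .
      qed
      have "v k \<otimes> g M \<otimes> u l
          = (\<Oplus>i\<in>{..<n}. v k \<otimes> (\<Oplus>j\<in>{..<n}. u i \<otimes> M (i, j) \<otimes> v j) \<otimes> u l)"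
        unfolding g_def using kl by (simp add: finsum_ldistr finsum_rdistr Pi_def)
      also have "\<dots> = (\<Oplus>i\<in>{..<n}. if k = i then M (i, l) else \<zero>)"
        using kl by (intro finsum_cong') (auto simp: inner)
      also have "\<dots> = M (k, l)"
        using kl by (subst add.finprod_singleton) auto
      finally show "?f (g M) p = M p" using kl by (simp add: p)
    qed
  qed
  with hom have "?f \<in> ring_iso A (mat_algebra n (corner A e))" by (simp add: ring_iso_def)
  moreover have "?f (c \<odot> a) = c \<odot>\<^bsub>mat_algebra n (corner A e)\<^esub> ?f a" if "a \<in> carrier A" for c a
    unfolding mat_algebra_simps using that by (intro matrix_eqI) auto
  ultimately show ?thesis by (simp add: alg_iso_def)
qed

lemma RDirProd_list_map_hom:
  assumes "\<And>f. f \<in> set fs \<Longrightarrow> h f \<in> ring_hom R (S f)"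
  shows "(\<lambda>a. map (\<lambda>f. h f a) fs) \<in> ring_hom R (RDirProd_list (map S fs))"
  using assms
proof (induction fs)
  case Nil
  then show ?case by (auto simp: ring_hom_def monoid.defs)
next
  case (Cons f fs)
  have "(\<lambda>a. (h f a, map (\<lambda>f. h f a) fs)) \<in> ring_hom R (RDirProd (S f) (RDirProd_list (map S fs)))"
    using Cons unfolding ring_hom_def RDirProd_def DirProd_def by (auto simp: monoid.defs)
  from ring_hom_trans[OF this RDirProd_list_hom1] show ?case by (simp add: comp_def)
qed

lemma direct_sum_algebra_simps:
  "carrier (direct_sum_algebra As) = carrier (RDirProd_list As)"
  "c \<odot>\<^bsub>direct_sum_algebra As\<^esub> as = map2 (\<lambda>A a. c \<odot>\<^bsub>A\<^esub> a) As as"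
  "ring_hom R (direct_sum_algebra As) = ring_hom R (RDirProd_list As)"
  by (simp_all add: direct_sum_algebra_def ring.defs module.defs ring_hom_def)

text \<open>
  A decomposition of the unit of a commutative algebra into orthogonal idempotents decomposes its
  matrix algebras: the component at \<open>f\<close> is multiplication of every entry by \<open>f\<close>.
\<close>

lemma (in assoc_algebra) alg_iso_mat_direct_sum:
  assumes comm: "\<And>a b. a \<in> carrier A \<Longrightarrow> b \<in> carrier A \<Longrightarrow> a \<otimes> b = b \<otimes> a"
    and fs: "\<And>f. f \<in> set fs \<Longrightarrow> f \<in> carrier A" "\<And>f. f \<in> set fs \<Longrightarrow> f \<otimes> f = f"
    and orth: "\<And>i j. i < length fs \<Longrightarrow> j < length fs \<Longrightarrow> i \<noteq> j \<Longrightarrow> fs ! i \<otimes> fs ! j = \<zero>"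
    and sum: "(\<Oplus>i\<in>{..<length fs}. fs ! i) = \<one>"
  shows "(\<lambda>M. map (\<lambda>f. \<lambda>(i, j)\<in>{..<n} \<times> {..<n}. f \<otimes> M (i, j)) fs)
     \<in> alg_iso (mat_algebra n A) (direct_sum_algebra (map (mat_algebra n) (map (corner A) fs)))"
    (is "?F \<in> _")
proof -
  define h where "h f M = (\<lambda>(i, j)\<in>{..<n} \<times> {..<n}. f \<otimes> M (i, j))" for f and M :: "nat \<times> nat \<Rightarrow> 'a"
  have F: "?F = (\<lambda>M. map (\<lambda>f. h f M) fs)" by (simp add: h_def)
  have Mc: "M (i, j) \<in> carrier A" if "M \<in> carrier (mat_algebra n A)" "i < n" "j < n" for M i j
    using that PiE_mem[of M "{..<n} \<times> {..<n}" _ "(i, j)"] by (auto simp: mat_algebra_simps)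
  have cc: "f \<otimes> a \<in> carrier (corner A f)" if "f \<in> set fs" "a \<in> carrier A" for f a
  proof -
    have "f \<otimes> (f \<otimes> a) = f \<otimes> a" using that fs by (simp add: m_assoc[symmetric])
    then show ?thesis using that fs comm[of "f \<otimes> a" f] by simp
  qed
  have hom: "h f \<in> ring_hom (mat_algebra n A) (mat_algebra n (corner A f))" if f: "f \<in> set fs" for f
  proof (rule ring_hom_memI)
    interpret B: assoc_algebra "corner A f" using corner_algebra fs[OF f] by blast
    note [simp] = fs[OF f]
    show "h f M \<in> carrier (mat_algebra n (corner A f))" if "M \<in> carrier (mat_algebra n A)" for M
      unfolding h_def using Mc[OF that] cc[OF f] by (intro mat_algebra_carrierI) blast
    fix M N assume M: "M \<in> carrier (mat_algebra n A)" and N: "N \<in> carrier (mat_algebra n A)"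
    note [simp] = Mc[OF M] Mc[OF N]
    show "h f (M \<oplus>\<^bsub>mat_algebra n A\<^esub> N) = h f M \<oplus>\<^bsub>mat_algebra n (corner A f)\<^esub> h f N"
      unfolding h_def mat_algebra_simps by (intro matrix_eqI) (auto simp: r_distr)
    show "h f (M \<otimes>\<^bsub>mat_algebra n A\<^esub> N) = h f M \<otimes>\<^bsub>mat_algebra n (corner A f)\<^esub> h f N"
      unfolding h_def mat_algebra_simps
    proof (rule matrix_eqI)
      fix i j assume ij: "i < n" "j < n"
      let ?M = "\<lambda>(i, j)\<in>{..<n} \<times> {..<n}. f \<otimes> M (i, j)"
      let ?N = "\<lambda>(i, j)\<in>{..<n} \<times> {..<n}. f \<otimes> N (i, j)"
      have "(\<Oplus>\<^bsub>corner A f\<^esub>k\<in>{..<n}. ?M (i, k) \<otimes>\<^bsub>corner A f\<^esub> ?N (k, j))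
          = (\<Oplus>\<^bsub>corner A f\<^esub>k\<in>{..<n}. (f \<otimes> M (i, k)) \<otimes>\<^bsub>corner A f\<^esub> (f \<otimes> N (k, j)))"
        by (rule B.finsum_cong') (use cc[OF f] ij B.m_closed in \<open>auto simp del: corner_simps\<close>)
      also have "\<dots> = (\<Oplus>k\<in>{..<n}. (f \<otimes> M (i, k)) \<otimes> (f \<otimes> N (k, j)))"
      proof (subst corner_finsum)
        show "(\<lambda>k. (f \<otimes> M (i, k)) \<otimes>\<^bsub>corner A f\<^esub> (f \<otimes> N (k, j))) \<in> {..<n} \<rightarrow> carrier (corner A f)"
          using cc[OF f] ij B.m_closed by (auto simp del: corner_simps)
      qed simp_all
      also have "\<dots> = (\<Oplus>k\<in>{..<n}. f \<otimes> (M (i, k) \<otimes> N (k, j)))"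
      proof (rule finsum_cong')
        fix k assume "k \<in> {..<n}"
        then have "(f \<otimes> M (i, k)) \<otimes> f = f \<otimes> M (i, k)" using cc[OF f, of "M (i, k)"] ij by simp
        then show "(f \<otimes> M (i, k)) \<otimes> (f \<otimes> N (k, j)) = f \<otimes> (M (i, k) \<otimes> N (k, j))"
          using ij \<open>k \<in> {..<n}\<close> by (simp add: m_assoc[symmetric])
      qed (use ij in auto)
      also have "\<dots> = f \<otimes> (\<Oplus>k\<in>{..<n}. M (i, k) \<otimes> N (k, j))"
        using ij by (subst finsum_rdistr) auto
      finally show "f \<otimes> (\<lambda>(i, j)\<in>{..<n} \<times> {..<n}. \<Oplus>k\<in>{..<n}. M (i, k) \<otimes> N (k, j)) (i, j)
          = (\<Oplus>\<^bsub>corner A f\<^esub>k\<in>{..<n}. ?M (i, k) \<otimes>\<^bsub>corner A f\<^esub> ?N (k, j))"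
        using ij by simp
    qed
  next
    show "h f \<one>\<^bsub>mat_algebra n A\<^esub> = \<one>\<^bsub>mat_algebra n (corner A f)\<^esub>"
      unfolding h_def mat_algebra_simps using fs[OF f] by (intro matrix_eqI) auto
  qed
  let ?As = "map (\<lambda>f. mat_algebra n (corner A f)) fs"
  have Fhom: "?F \<in> ring_hom (mat_algebra n A) (direct_sum_algebra ?As)"
    unfolding F direct_sum_algebra_simps using hom by (rule RDirProd_list_map_hom)
  have fsc [simp]: "fs ! i \<in> carrier A" if "i < length fs" for i using fs that by simp
  have "bij_betw ?F (carrier (mat_algebra n A)) (carrier (direct_sum_algebra ?As))"
  proof (rule bij_betwI)
    define g where "g Ms = (\<lambda>(i, j)\<in>{..<n} \<times> {..<n}. \<Oplus>k\<in>{..<length fs}. (Ms ! k) (i, j))"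
      for Ms :: "(nat \<times> nat \<Rightarrow> 'a) list"
    have Msc: "length Ms = length fs"
      "\<And>k. k < length fs \<Longrightarrow> Ms ! k \<in> ({..<n} \<times> {..<n}) \<rightarrow>\<^sub>E carrier (corner A (fs ! k))"
      if "Ms \<in> carrier (direct_sum_algebra ?As)" for Ms
      using RDirProd_list_carrier_mem[of Ms ?As] that
      by (auto simp: direct_sum_algebra_simps mat_algebra_simps)
    have Msc': "(Ms ! k) (i, j) \<in> carrier A" "(fs ! k) \<otimes> (Ms ! k) (i, j) = (Ms ! k) (i, j)"
      if "Ms \<in> carrier (direct_sum_algebra ?As)" "k < length fs" "i < n" "j < n" for Ms k i j
      using PiE_mem[OF Msc(2)[OF that(1,2)], of "(i, j)"] that by auto
    show "?F \<in> carrier (mat_algebra n A) \<rightarrow> carrier (direct_sum_algebra ?As)"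
      using Fhom by (auto simp: ring_hom_def)
    show "g \<in> carrier (direct_sum_algebra ?As) \<rightarrow> carrier (mat_algebra n A)"
      unfolding g_def using Msc' by (intro funcsetI mat_algebra_carrierI finsum_closed) auto
    show "g (?F M) = M" if M: "M \<in> carrier (mat_algebra n A)" for M
    proof (rule extensionalityI[where A = "{..<n} \<times> {..<n}"])
      show "g (?F M) \<in> extensional ({..<n} \<times> {..<n})" by (simp add: g_def)
      show "M \<in> extensional ({..<n} \<times> {..<n})" using M by (simp add: mat_algebra_simps PiE_def)
      fix p :: "nat \<times> nat" assume "p \<in> {..<n} \<times> {..<n}"
      then obtain i j where p: "p = (i, j)" and ij: "i < n" "j < n" by auto
      have "(\<Oplus>k\<in>{..<length fs}. (?F M ! k) (i, j)) = (\<Oplus>k\<in>{..<length fs}. fs ! k \<otimes> M (i, j))"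
        using ij Mc[OF M] by (intro finsum_cong') auto
      also have "\<dots> = M (i, j)"
        using ij Mc[OF M] by (simp add: finsum_ldistr[symmetric] sum)
      finally show "g (?F M) p = M p" using ij by (simp add: g_def p)
    qed
    show "?F (g Ms) = Ms" if Ms: "Ms \<in> carrier (direct_sum_algebra ?As)" for Ms
    proof (rule nth_equalityI)
      show "length (?F (g Ms)) = length Ms" using Msc[OF Ms] by simp
      fix l assume "l < length (?F (g Ms))"
      then have l: "l < length fs" by simp
      have "h (fs ! l) (g Ms) = Ms ! l"
      proof (rule extensionalityI[where A = "{..<n} \<times> {..<n}"])
        show "h (fs ! l) (g Ms) \<in> extensional ({..<n} \<times> {..<n})" by (simp add: h_def)
        show "Ms ! l \<in> extensional ({..<n} \<times> {..<n})" using Msc(2)[OF Ms l] by (simp add: PiE_def)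
        fix p :: "nat \<times> nat" assume "p \<in> {..<n} \<times> {..<n}"
        then obtain i j where p: "p = (i, j)" and ij: "i < n" "j < n" by auto
        note [simp] = Msc'[OF Ms]
        have "fs ! l \<otimes> (\<Oplus>k\<in>{..<length fs}. (Ms ! k) (i, j))
            = (\<Oplus>k\<in>{..<length fs}. fs ! l \<otimes> (Ms ! k) (i, j))"
          using ij l by (subst finsum_rdistr) auto
        also have "\<dots> = (\<Oplus>k\<in>{..<length fs}. if l = k then (Ms ! k) (i, j) else \<zero>)"
        proof (rule finsum_cong')
          fix k assume "k \<in> {..<length fs}"
          then have k: "k < length fs" by simp
          have "fs ! l \<otimes> (Ms ! k) (i, j) = (fs ! l \<otimes> fs ! k) \<otimes> (Ms ! k) (i, j)"
            using ij l k by (simp add: m_assoc)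
          then show "fs ! l \<otimes> (Ms ! k) (i, j) = (if l = k then (Ms ! k) (i, j) else \<zero>)"
            using ij l k orth[OF l k] by auto
        qed (use ij l in auto)
        also have "\<dots> = (Ms ! l) (i, j)"
          using ij l by (subst add.finprod_singleton) auto
        finally show "h (fs ! l) (g Ms) p = (Ms ! l) p" using ij by (simp add: p h_def g_def)
      qed
      then show "?F (g Ms) ! l = Ms ! l" using l by (simp add: h_def)
    qed
  qed
  with Fhom have "?F \<in> ring_iso (mat_algebra n A) (direct_sum_algebra ?As)"
    by (simp add: ring_iso_def)
  moreover have "?F (c \<odot>\<^bsub>mat_algebra n A\<^esub> M) = c \<odot>\<^bsub>direct_sum_algebra ?As\<^esub> ?F M"
    if "M \<in> carrier (mat_algebra n A)" for c M
    unfolding mat_algebra_simps direct_sum_algebra_simps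
    using Mc[OF that] fs by (auto simp: map2_map_map mat_algebra_simps intro!: matrix_eqI)
  ultimately show ?thesis by (simp add: alg_iso_def comp_def)
qed

lemma alg_iso_trans:
  assumes "f \<in> alg_iso A B" "g \<in> alg_iso B C"
  shows "g \<circ> f \<in> alg_iso A C"
proof -
  have "f a \<in> carrier B" if "a \<in> carrier A" for a
    using assms(1) that by (auto simp: alg_iso_def ring_iso_def ring_hom_def)
  with assms show ?thesis by (auto simp: alg_iso_def ring_iso_set_trans)
qed

section \<open>Algebras presented by generators and relations\<close>

lemma free_alg_induct [case_names one gen scale add]:
  fixes p :: "('g, 'k::field) free_alg"
  assumes one: "P 1"
    and gen: "\<And>s p. P p \<Longrightarrow> P (var s * p)"
    and scale: "\<And>c p. P p \<Longrightarrow> P (scal c * p)"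
    and add: "\<And>p r. P p \<Longrightarrow> P r \<Longrightarrow> P (p + r)"
  shows "P p"
proof -
  have mono: "P (Poly_Mapping.single (Word ws) 1)" for ws
  proof (induction ws)
    case Nil
    then show ?case using one single_one by (metis zero_word_def)
  next
    case (Cons s ws)
    have "Poly_Mapping.single (Word (s # ws)) 1 = var s * Poly_Mapping.single (Word ws) (1 :: 'k)"
      by (simp add: var_def mult_single plus_word_def)
    then show ?case using gen[OF Cons] by simp
  qed
  have single: "P (Poly_Mapping.single w c)" for w c
  proof -
    have "Poly_Mapping.single w c = scal c * Poly_Mapping.single w 1"
      by (simp add: scal_def mult_single)
    then show ?thesis using scale[OF mono[of "letters w"]] by simp
  qed
  show ?thesis
  proof (induction p rule: update_induct)
    case const
    have "P (scal 0 * 1)" by (rule scale[OF one])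
    then show ?case by (simp add: scal_def)
  next
    case (update p w c)
    have "Poly_Mapping.update w c p = p + Poly_Mapping.single w c"
      using update.hyps
      by (intro poly_mapping_eqI) (auto simp: lookup_update lookup_add lookup_single in_keys_iff)
    then show ?case using add[OF update.IH single] by simp
  qed
qed

lemma scal_central: "p * scal c = scal c * p"
proof (induction p rule: free_alg_induct)
  case (gen s p)
  have *: "scal c * var s = var s * scal c" by (simp add: scal_def var_def mult_single)
  have "var s * p * scal c = (var s * scal c) * p" by (simp only: mult.assoc gen)
  then show ?case by (simp only: *[symmetric] mult.assoc)
next
  case (scale d p)
  have *: "scal c * scal d = scal d * scal c" by (simp add: scal_def mult_single mult.commute)
  have "scal d * p * scal c = (scal d * scal c) * p" by (simp only: mult.assoc scale)
  then show ?case by (simp only: *[symmetric] mult.assoc)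
qed (simp_all add: distrib_left distrib_right)

lemma scal_mult: "scal c * scal d = scal (c * d)"
  by (simp add: scal_def mult_single)

lemma scal_add: "scal (c + d) = scal c + scal d"
  by (simp add: scal_def single_add)

lemma scal_1 [simp]: "scal 1 = 1"
  by (simp add: scal_def)

lemma free_algebra_simps:
  "carrier free_algebra = UNIV" "p \<otimes>\<^bsub>free_algebra\<^esub> r = p * r" "\<one>\<^bsub>free_algebra\<^esub> = 1"
  "\<zero>\<^bsub>free_algebra\<^esub> = 0" "p \<oplus>\<^bsub>free_algebra\<^esub> r = p + r" "c \<odot>\<^bsub>free_algebra\<^esub> p = scal c * p"
  by (simp_all add: free_algebra_def ring_of_type_algebra_def ring.defs module.defs)

lemma assoc_algebra_free: "assoc_algebra (free_algebra :: ('k::field, ('g, 'k) free_alg) module)"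
proof -
  have "ring (free_algebra :: ('k::field, ('g, 'k) free_alg) module)"
  proof (rule ringI)
    show "abelian_group (free_algebra :: ('k::field, ('g, 'k) free_alg) module)"
    proof (rule abelian_groupI)
      fix p :: "('g, 'k) free_alg"
      show "\<exists>r\<in>carrier free_algebra. r \<oplus>\<^bsub>free_algebra\<^esub> p = \<zero>\<^bsub>free_algebra\<^esub>"
        by (intro bexI[of _ "- p"]) (simp_all add: free_algebra_simps)
    qed (auto simp: free_algebra_simps algebra_simps)
    show "monoid (free_algebra :: ('k::field, ('g, 'k) free_alg) module)"
      by (rule monoidI) (auto simp: free_algebra_simps mult.assoc)
  qed (auto simp: free_algebra_simps algebra_simps)
  then interpret ring "free_algebra :: ('k::field, ('g, 'k) free_alg) module" .
  show ?thesis
  proof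
    show "p \<otimes>\<^bsub>free_algebra\<^esub> (c \<odot>\<^bsub>free_algebra\<^esub> r) = c \<odot>\<^bsub>free_algebra\<^esub> (p \<otimes>\<^bsub>free_algebra\<^esub> r)"
      for c and p r :: "('g, 'k) free_alg"
      by (simp add: free_algebra_simps scal_central[of p c] flip: mult.assoc)
  qed (simp_all add: free_algebra_simps scal_add distrib_left distrib_right mult.assoc
         flip: scal_mult)
qed

lemma (in assoc_algebra) quot_algebra:
  assumes I: "ideal I A"
  shows "assoc_algebra (quot_algebra A I)"
    and "carrier (quot_algebra A I) = (+>) I ` carrier A"
    and "(+>) I \<in> ring_hom A (quot_algebra A I)"
    and "\<And>c a. a \<in> carrier A \<Longrightarrow> I +> (c \<odot> a) = c \<odot>\<^bsub>quot_algebra A I\<^esub> (I +> a)"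
    and "\<And>a. a \<in> I \<Longrightarrow> I +> a = \<zero>\<^bsub>quot_algebra A I\<^esub>"
proof -
  let ?Q = "quot_algebra A I"
  interpret I: ideal I A by fact
  note Qdef = quot_algebra_def FactRing_def ring.defs module.defs
  show carrier: "carrier ?Q = (+>) I ` carrier A"
    by (auto simp: Qdef A_RCOSETS_def')
  interpret R: ring "A Quot I" by (rule I.quotient_is_ring)
  have ops: "carrier ?Q = carrier (A Quot I)" "monoid.mult ?Q = monoid.mult (A Quot I)"
    "\<one>\<^bsub>?Q\<^esub> = \<one>\<^bsub>A Quot I\<^esub>" "\<zero>\<^bsub>?Q\<^esub> = \<zero>\<^bsub>A Quot I\<^esub>" "ring.add ?Q = ring.add (A Quot I)"
    by (simp_all add: Qdef)
  have "ring ?Q"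
  proof (rule ringI)
    show "abelian_group ?Q"
    proof (rule abelian_groupI)
      fix x assume "x \<in> carrier ?Q"
      then show "\<exists>y\<in>carrier ?Q. y \<oplus>\<^bsub>?Q\<^esub> x = \<zero>\<^bsub>?Q\<^esub>"
        unfolding ops by (intro bexI[of _ "\<ominus>\<^bsub>A Quot I\<^esub> x"]) (simp_all add: R.l_neg)
    qed (simp_all add: ops R.a_ac)
    show "monoid ?Q" by (rule monoidI) (simp_all add: ops R.m_assoc)
  qed (simp_all add: ops R.l_distr R.r_distr)
  then interpret Q: ring ?Q .
  show hom: "(+>) I \<in> ring_hom A ?Q"
    using I.rcos_ring_hom by (simp add: ring_hom_def Qdef)
  show zero: "I +> a = \<zero>\<^bsub>?Q\<^esub>" if "a \<in> I" for a
    using I.a_rcos_const[OF that] by (simp add: Qdef)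
  have cI: "c \<odot> a \<in> I" if "a \<in> I" for c a
  proof -
    have "(c \<odot> \<one>) \<otimes> a \<in> I" using that by (intro I.I_l_closed) auto
    then show ?thesis using I.a_Hcarr[OF that] by simp
  qed
  show smult: "I +> (c \<odot> a) = c \<odot>\<^bsub>?Q\<^esub> (I +> a)" if a: "a \<in> carrier A" for c a
  proof -
    have const: "I +> (c \<odot> s) = I +> (c \<odot> a)" if "s \<in> I +> a" for s
    proof -
      from that obtain i where i: "i \<in> I" "s = i \<oplus> a" by (auto simp: a_r_coset_def')
      then have "i \<in> carrier A" by (rule_tac I.a_Hcarr)
      then have "I +> (c \<odot> s) = (I +> (c \<odot> i)) \<oplus>\<^bsub>?Q\<^esub> (I +> (c \<odot> a))"
        using a by (simp add: i smult_r_distr ring_hom_add[OF hom])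
      also have "\<dots> = I +> (c \<odot> a)"
        using zero[OF cI[OF i(1)]] ring_hom_closed[OF hom, of "c \<odot> a"] a by simp
      finally show ?thesis .
    qed
    have "c \<odot>\<^bsub>?Q\<^esub> (I +> a) = (\<Union>s\<in>I +> a. I +> (c \<odot> s))" by (simp add: Qdef)
    also have "\<dots> = (\<Union>s\<in>I +> a. I +> (c \<odot> a))" using const by (intro SUP_cong refl)
    also have "\<dots> = I +> (c \<odot> a)" using I.a_rcos_self[OF a] by (simp only: UN_constant if_False) auto
    finally show ?thesis by (rule sym)
  qed
  note lift = smult[symmetric] ring_hom_add[OF hom, symmetric] ring_hom_mult[OF hom, symmetric]
  show "assoc_algebra ?Q"
  proof
    fix c d :: 'k and S T :: "'a set" assume "S \<in> carrier ?Q"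
    then obtain x where x: "x \<in> carrier A" "S = I +> x" unfolding carrier by blast
    show "c \<odot>\<^bsub>?Q\<^esub> S \<in> carrier ?Q"
      unfolding carrier x(2) lift(1)[OF x(1)] by (intro imageI smult_closed x(1))
    show "(c + d) \<odot>\<^bsub>?Q\<^esub> S = c \<odot>\<^bsub>?Q\<^esub> S \<oplus>\<^bsub>?Q\<^esub> d \<odot>\<^bsub>?Q\<^esub> S"
      by (simp only: x lift smult_l_distr smult_closed)
    show "c \<odot>\<^bsub>?Q\<^esub> (d \<odot>\<^bsub>?Q\<^esub> S) = (c * d) \<odot>\<^bsub>?Q\<^esub> S"
      by (simp only: x lift smult_smult smult_closed)
    show "1 \<odot>\<^bsub>?Q\<^esub> S = S"
      by (simp only: x lift smult_one smult_closed)
    assume "T \<in> carrier ?Q"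
    then obtain y where y: "y \<in> carrier A" "T = I +> y" unfolding carrier by blast
    show "c \<odot>\<^bsub>?Q\<^esub> (S \<oplus>\<^bsub>?Q\<^esub> T) = c \<odot>\<^bsub>?Q\<^esub> S \<oplus>\<^bsub>?Q\<^esub> c \<odot>\<^bsub>?Q\<^esub> T"
      by (simp only: x y lift smult_r_distr smult_closed a_closed)
    show "(c \<odot>\<^bsub>?Q\<^esub> S) \<otimes>\<^bsub>?Q\<^esub> T = c \<odot>\<^bsub>?Q\<^esub> (S \<otimes>\<^bsub>?Q\<^esub> T)"
      by (simp only: x y lift smult_mult_left smult_closed m_closed)
    show "S \<otimes>\<^bsub>?Q\<^esub> (c \<odot>\<^bsub>?Q\<^esub> T) = c \<odot>\<^bsub>?Q\<^esub> (S \<otimes>\<^bsub>?Q\<^esub> T)"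
      by (simp only: x y lift smult_mult_right smult_closed m_closed)
  qed
qed

text \<open>
  The class of an element of the free algebra in the algebra presented by \<open>rels\<close>.
\<close>

definition residue :: "('g, 'k::field) free_alg set \<Rightarrow> ('g, 'k) free_alg \<Rightarrow> ('g, 'k) free_alg set" where
  "residue rels p = genideal free_algebra rels +>\<^bsub>free_algebra\<^esub> p"

lemma presented_algebra:
  fixes rels :: "('g, 'k::field) free_alg set"
  defines "A \<equiv> presented_algebra rels"
  shows "assoc_algebra A"
    and "carrier A = range (residue rels)"
    and "residue rels 1 = \<one>\<^bsub>A\<^esub>"
    and "residue rels (p + r) = residue rels p \<oplus>\<^bsub>A\<^esub> residue rels r"
    and "residue rels (p * r) = residue rels p \<otimes>\<^bsub>A\<^esub> residue rels r"
    and "residue rels (scal c * p) = c \<odot>\<^bsub>A\<^esub> residue rels p"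
    and "p \<in> rels \<Longrightarrow> residue rels p = \<zero>\<^bsub>A\<^esub>"
proof -
  let ?F = "free_algebra :: ('k, ('g, 'k) free_alg) module"
  interpret F: assoc_algebra ?F by (rule assoc_algebra_free)
  have I: "ideal (genideal ?F rels) ?F" by (rule F.genideal_ideal) (simp add: free_algebra_simps)
  note Q = F.quot_algebra[OF I, folded presented_algebra_def A_def, folded residue_def[abs_def]]
  show "assoc_algebra A" by (rule Q(1))
  show "carrier A = range (residue rels)"
    using Q(2) by (simp add: free_algebra_simps residue_def[abs_def])
  have hom: "residue rels \<in> ring_hom ?F A" using Q(3) by (simp add: residue_def[abs_def])
  note h = ring_hom_memE[OF hom, unfolded free_algebra_simps]
  show "residue rels 1 = \<one>\<^bsub>A\<^esub>" by (rule h(4))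
  show "residue rels (p + r) = residue rels p \<oplus>\<^bsub>A\<^esub> residue rels r" by (rule h(3)) auto
  show "residue rels (p * r) = residue rels p \<otimes>\<^bsub>A\<^esub> residue rels r" by (rule h(2)) auto
  show "residue rels (scal c * p) = c \<odot>\<^bsub>A\<^esub> residue rels p"
    using Q(4)[of p c] by (simp add: free_algebra_simps residue_def)
  show "residue rels p = \<zero>\<^bsub>A\<^esub>" if "p \<in> rels"
    using Q(5)[of p] F.genideal_self[of rels] that by (auto simp: free_algebra_simps residue_def)
qed

context
  fixes rels :: "('g, 'k::field) free_alg set"
begin

interpretation A: assoc_algebra "presented_algebra rels"
  by (rule presented_algebra)

lemma residue_closed: "residue rels p \<in> carrier (presented_algebra rels)"
  by (simp add: presented_algebra)

lemma residue_pow: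
  "residue rels (p ^ n) = residue rels p [^]\<^bsub>presented_algebra rels\<^esub> (n :: nat)"
  by (induction n) (simp_all add: presented_algebra power_Suc2 del: power_Suc)

lemma residue_scal: "residue rels (scal c) = c \<odot>\<^bsub>presented_algebra rels\<^esub> \<one>\<^bsub>presented_algebra rels\<^esub>"
  using presented_algebra(6)[of rels c 1] by (simp add: presented_algebra)

lemma residue_0: "residue rels 0 = \<zero>\<^bsub>presented_algebra rels\<^esub>"
  using presented_algebra(6)[of rels 0 1] by (simp add: presented_algebra(3) scal_def)

lemma residue_eqI:
  assumes "p - r \<in> rels"
  shows "residue rels p = residue rels r"
proof -
  have "residue rels p = residue rels ((p - r) + r)" by simp
  also have "\<dots> = residue rels r"
    unfolding presented_algebra(4) presented_algebra(7)[OF assms] using residue_closed by simp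
  finally show ?thesis .
qed

lemma presented_algebra_induct [consumes 1, case_names one gen scale add]:
  assumes "a \<in> carrier (presented_algebra rels)"
    and "P \<one>\<^bsub>presented_algebra rels\<^esub>"
    and "\<And>s a. a \<in> carrier (presented_algebra rels) \<Longrightarrow> P a
           \<Longrightarrow> P (residue rels (var s) \<otimes>\<^bsub>presented_algebra rels\<^esub> a)"
    and "\<And>c a. a \<in> carrier (presented_algebra rels) \<Longrightarrow> P a
           \<Longrightarrow> P (c \<odot>\<^bsub>presented_algebra rels\<^esub> a)"
    and "\<And>a b. a \<in> carrier (presented_algebra rels) \<Longrightarrow> b \<in> carrier (presented_algebra rels)
           \<Longrightarrow> P a \<Longrightarrow> P b \<Longrightarrow> P (a \<oplus>\<^bsub>presented_algebra rels\<^esub> b)"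
  shows "P a"
proof -
  have "P (residue rels p)" for p
  proof (induction p rule: free_alg_induct)
    case one
    then show ?case by (simp only: presented_algebra(3) assms(2))
  next
    case (gen s p)
    show ?case unfolding presented_algebra(5) by (rule assms(3)[OF residue_closed gen])
  next
    case (scale c p)
    show ?case unfolding presented_algebra(6) by (rule assms(4)[OF residue_closed scale])
  next
    case (add p r)
    show ?case unfolding presented_algebra(4) by (rule assms(5)[OF residue_closed residue_closed add])
  qed
  then show ?thesis using assms(1) by (auto simp: presented_algebra(2))
qed

end

section \<open>Clock and shift matrices\<close>

context assoc_algebra
begin

lemma smult_finsum:
  "f \<in> I \<rightarrow> carrier A \<Longrightarrow> c \<odot> (\<Oplus>i\<in>I. f i) = (\<Oplus>i\<in>I. c \<odot> f i)"
proof (induction I rule: infinite_finite_induct)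
  case (insert i I)
  then show ?case by (simp add: smult_r_distr Pi_def)
qed (simp_all add: finsum_infinite)

lemma finsum_smult:
  "a \<in> carrier A \<Longrightarrow> (\<Oplus>i\<in>I. c i \<odot> a) = (\<Sum>i\<in>I. c i) \<odot> a"
  by (induction I rule: infinite_finite_induct) (auto simp: smult_l_distr finsum_infinite)

lemma finsum_swap:
  assumes "finite I" and J: "finite J" and "\<And>i j. i \<in> I \<Longrightarrow> j \<in> J \<Longrightarrow> f i j \<in> carrier A"
  shows "(\<Oplus>i\<in>I. \<Oplus>j\<in>J. f i j) = (\<Oplus>j\<in>J. \<Oplus>i\<in>I. f i j)"
  using assms(1,3)
proof (induction I)
  case (insert i I)
  have "(\<Oplus>j\<in>J. \<Oplus>i\<in>insert i I. f i j) = (\<Oplus>j\<in>J. f i j \<oplus> (\<Oplus>i\<in>I. f i j))"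
    using insert by (intro finsum_cong') (auto intro!: finsum_closed)
  also have "\<dots> = (\<Oplus>j\<in>J. f i j) \<oplus> (\<Oplus>j\<in>J. \<Oplus>i\<in>I. f i j)"
    using insert.prems by (intro finsum_addf) (auto intro!: finsum_closed)
  finally show ?case using insert by (simp add: Pi_def)
qed simp

end

lemma primitive_root_power_eq_1_iff:
  assumes "primitive_root_of_unity n q"
  shows "q ^ k = 1 \<longleftrightarrow> n dvd k"
proof
  have n: "n > 0" "q ^ n = 1" "\<And>e. 0 < e \<Longrightarrow> e < n \<Longrightarrow> q ^ e \<noteq> 1"
    using assms by (auto simp: primitive_root_of_unity_def)
  assume "q ^ k = 1"
  have "q ^ k = (q ^ n) ^ (k div n) * q ^ (k mod n)"
    by (simp flip: power_mult power_add)
  with n \<open>q ^ k = 1\<close> have "q ^ (k mod n) = 1" by simp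
  with n have "k mod n = 0" using mod_less_divisor by blast
  then show "n dvd k" by auto
next
  assume "n dvd k"
  then show "q ^ k = 1" using assms by (auto simp: primitive_root_of_unity_def power_mult elim!: dvdE)
qed

lemma primitive_root_of_unity_inverse:
  "primitive_root_of_unity n q \<Longrightarrow> primitive_root_of_unity n (inverse q)"
  by (auto simp: primitive_root_of_unity_def power_inverse)

text \<open>
  Elements \<open>g\<close> and \<open>x\<close> behaving like the clock and shift matrices of size \<open>n\<close>: both have order
  dividing \<open>n\<close>, and they commute up to a primitive \<open>n\<close>-th root of unity.
\<close>

locale clock_shift = assoc_algebra A for A :: "('k::field_char_0, 'a) module" (structure) +
  fixes n :: nat and q :: 'k and g x :: 'a
  assumes q: "primitive_root_of_unity n q"
    and g [simp, intro]: "g \<in> carrier A" and x [simp, intro]: "x \<in> carrier A"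
    and g_n: "g [^] n = \<one>" and x_n: "x [^] n = \<one>"
    and g_x: "g \<otimes> x = q \<odot> (x \<otimes> g)"
begin

lemma n_pos: "n > 0" and q_n: "q ^ n = 1" and q_nz [simp]: "q \<noteq> 0"
  using q by (auto simp: primitive_root_of_unity_def power_0_left)

lemma g_x_pow: "g \<otimes> x [^] i = q ^ i \<odot> (x [^] i \<otimes> g)"
proof (induction i)
  case (Suc i)
  have "g \<otimes> x [^] Suc i = (g \<otimes> x [^] i) \<otimes> x" by (simp add: m_assoc)
  also have "\<dots> = q ^ Suc i \<odot> (x [^] Suc i \<otimes> g)"
    by (simp add: Suc m_assoc g_x mult.commute)
  finally show ?case .
qed simp

lemma g_pow_x_pow: "g [^] k \<otimes> x [^] i = q ^ (k * i) \<odot> (x [^] i \<otimes> g [^] k)"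
proof (induction k)
  case (Suc k)
  have "g [^] Suc k \<otimes> x [^] i = g [^] k \<otimes> (g \<otimes> x [^] i)" by (simp add: m_assoc)
  also have "\<dots> = q ^ i \<odot> ((g [^] k \<otimes> x [^] i) \<otimes> g)" by (simp add: g_x_pow m_assoc)
  also have "\<dots> = q ^ (Suc k * i) \<odot> (x [^] i \<otimes> g [^] Suc k)"
    by (simp add: Suc m_assoc power_add)
  finally show ?case .
qed simp

text \<open>
  The idempotent projecting onto the fixed space of \<open>g\<close>.
\<close>

definition e where "e = inverse (of_nat n) \<odot> (\<Oplus>k\<in>{..<n}. g [^] k)"

lemma e_closed [simp, intro]: "e \<in> carrier A"
  by (simp add: e_def Pi_def)

lemma g_e [simp]: "g \<otimes> e = e" and e_g [simp]: "e \<otimes> g = e"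
proof -
  obtain k where n: "n = Suc k" using n_pos gr0_implies_Suc by blast
  have "(\<Oplus>i\<in>{..k}. g [^] Suc i) \<oplus> g [^] (0::nat) = (\<Oplus>i\<in>{..Suc k}. g [^] i)"
    by (rule finsum_Suc2[symmetric]) auto
  also have "\<dots> = g [^] Suc k \<oplus> (\<Oplus>i\<in>{..k}. g [^] i)"
    by (rule finsum_Suc) auto
  also have "\<dots> = (\<Oplus>i\<in>{..k}. g [^] i) \<oplus> g [^] (0::nat)"
    using g_n by (simp add: n a_comm Pi_def)
  finally have *: "(\<Oplus>i\<in>{..<n}. g [^] Suc i) = (\<Oplus>i\<in>{..<n}. g [^] i)"
    by (subst (asm) add.r_cancel) (auto simp: n lessThan_Suc_atMost)
  have "g \<otimes> (\<Oplus>i\<in>{..<n}. g [^] i) = (\<Oplus>i\<in>{..<n}. g [^] Suc i)"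
    unfolding nat_pow_Suc2[OF g] by (rule finsum_rdistr) auto
  then show "g \<otimes> e = e" unfolding * by (simp add: e_def Pi_def)
  have "(\<Oplus>i\<in>{..<n}. g [^] i) \<otimes> g = (\<Oplus>i\<in>{..<n}. g [^] Suc i)"
    unfolding nat_pow_Suc by (rule finsum_ldistr) auto
  then show "e \<otimes> g = e" unfolding * by (simp add: e_def Pi_def)
qed

lemma g_pow_e [simp]: "g [^] (k::nat) \<otimes> e = e" and e_g_pow [simp]: "e \<otimes> g [^] (k::nat) = e"
  by (induction k) (simp_all add: m_assoc, simp add: m_assoc[symmetric])

lemma e_idem [simp]: "e \<otimes> e = e"
proof -
  have "e \<otimes> (\<Oplus>k\<in>{..<n}. g [^] k) = (\<Oplus>k\<in>{..<n}. 1 \<odot> e)"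
    by (subst finsum_rdistr) auto
  also have "\<dots> = of_nat n \<odot> e" by (subst finsum_smult) auto
  finally have "inverse (of_nat n) \<odot> (e \<otimes> (\<Oplus>k\<in>{..<n}. g [^] k)) = e" using n_pos by simp
  moreover have "e \<otimes> e = inverse (of_nat n) \<odot> (e \<otimes> (\<Oplus>k\<in>{..<n}. g [^] k))"
    by (subst (2) e_def) (simp add: Pi_def)
  ultimately show ?thesis by simp
qed

lemma e_x_pow_e: "e \<otimes> x [^] i \<otimes> e = (if n dvd i then e else \<zero>)"
proof (cases "n dvd i")
  case True
  then obtain k where "i = n * k" by (auto elim: dvdE)
  then have "x [^] i = \<one>" by (simp add: x_n flip: nat_pow_pow)
  with True show ?thesis by simp
next
  case False
  \<comment> \<open>Moving a factor \<open>g\<close> from the left to the right idempotent multiplies by \<open>q ^ i \<noteq> 1\<close>.\<close>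
  have "e \<otimes> x [^] i \<otimes> e = (e \<otimes> g) \<otimes> x [^] i \<otimes> e" by simp
  also have "\<dots> = e \<otimes> (g \<otimes> x [^] i) \<otimes> e" by (simp add: m_assoc del: e_g)
  also have "\<dots> = q ^ i \<odot> (e \<otimes> x [^] i \<otimes> e)" by (simp add: g_x_pow m_assoc)
  finally have "(q ^ i) \<odot> (e \<otimes> x [^] i \<otimes> e) \<oplus> (- 1) \<odot> (e \<otimes> x [^] i \<otimes> e) = \<zero>"
    by (simp add: smult_uminus r_neg)
  then have "(q ^ i - 1) \<odot> (e \<otimes> x [^] i \<otimes> e) = \<zero>"
    using smult_l_distr[of "e \<otimes> x [^] i \<otimes> e" "q ^ i" "- 1"] by simp
  moreover have "q ^ i - 1 \<noteq> 0" using False primitive_root_power_eq_1_iff[OF q] by simp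
  ultimately show ?thesis using False smult_cancel by (metis e_closed m_closed nat_pow_closed x)
qed

text \<open>
  The element \<open>x\<^sup>i e x\<^sup>n\<^sup>-\<^sup>i\<close> projects onto an eigenspace of \<open>g\<close>. Expanding \<open>e\<close> in powers of \<open>g\<close>, the
  sum of these projections reduces to geometric sums of powers of \<open>q\<close>, which vanish except at
  \<open>g\<^sup>0\<close>.
\<close>

lemma sum_x_e_x: "(\<Oplus>i\<in>{..<n}. (x [^] i \<otimes> e) \<otimes> (e \<otimes> x [^] (n - i))) = \<one>"
proof -
  have summand: "(x [^] i \<otimes> e) \<otimes> (e \<otimes> x [^] (n - i))
      = (\<Oplus>k\<in>{..<n}. (inverse (of_nat n) * (q ^ k) ^ (n - i)) \<odot> g [^] k)" if "i < n" for i
  proof -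
    have "(x [^] i \<otimes> e) \<otimes> (e \<otimes> x [^] (n - i)) = x [^] i \<otimes> (e \<otimes> e) \<otimes> x [^] (n - i)"
      by (simp only: m_assoc x e_closed nat_pow_closed m_closed)
    also have "\<dots> = inverse (of_nat n) \<odot> (x [^] i \<otimes> (\<Oplus>k\<in>{..<n}. g [^] k) \<otimes> x [^] (n - i))"
      by (simp add: Pi_def e_idem) (simp add: e_def Pi_def)
    also have "x [^] i \<otimes> (\<Oplus>k\<in>{..<n}. g [^] k) \<otimes> x [^] (n - i)
        = (\<Oplus>k\<in>{..<n}. x [^] i \<otimes> g [^] k \<otimes> x [^] (n - i))"
      by (simp add: finsum_rdistr finsum_ldistr Pi_def)
    also have "\<dots> = (\<Oplus>k\<in>{..<n}. (q ^ k) ^ (n - i) \<odot> g [^] k)"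
    proof (rule finsum_cong')
      fix k :: nat
      have "x [^] i \<otimes> g [^] k \<otimes> x [^] (n - i) = x [^] i \<otimes> (g [^] k \<otimes> x [^] (n - i))"
        by (simp add: m_assoc)
      also have "\<dots> = q ^ (k * (n - i)) \<odot> ((x [^] i \<otimes> x [^] (n - i)) \<otimes> g [^] k)"
        by (simp add: g_pow_x_pow m_assoc)
      also have "x [^] i \<otimes> x [^] (n - i) = \<one>"
        using that by (simp add: nat_pow_mult x_n)
      finally show "x [^] i \<otimes> g [^] k \<otimes> x [^] (n - i) = (q ^ k) ^ (n - i) \<odot> g [^] k"
        by (simp add: power_mult)
    qed auto
    finally show ?thesis by (simp add: smult_finsum Pi_def)
  qed
  have geometric: "(\<Sum>i<n. (q ^ k) ^ (n - i)) = (if k = 0 then of_nat n else 0)" if "k < n" for k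
  proof (cases "k = 0")
    case False
    have "(\<Sum>i<n. (q ^ k) ^ (n - i)) = (\<Sum>i<n. (q ^ k) ^ Suc (n - Suc i))"
      by (intro sum.cong) (auto simp: Suc_diff_Suc)
    also have "\<dots> = (\<Sum>i<n. (q ^ k) ^ Suc i)"
      by (rule sum.nat_diff_reindex)
    also have "\<dots> = q ^ k * (\<Sum>i<n. (q ^ k) ^ i)"
      by (simp add: sum_distrib_left)
    also have "(1 - q ^ k) * (\<Sum>i<n. (q ^ k) ^ i) = 0"
      by (simp only: one_diff_power_eq[symmetric]) (metis diff_self mult.commute power_mult power_one q_n)
    then have "(\<Sum>i<n. (q ^ k) ^ i) = 0"
      using primitive_root_power_eq_1_iff[OF q, of k] False that by (auto dest: dvd_imp_le)
    finally show ?thesis using False by simp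
  qed simp
  have "(\<Oplus>i\<in>{..<n}. (x [^] i \<otimes> e) \<otimes> (e \<otimes> x [^] (n - i)))
      = (\<Oplus>i\<in>{..<n}. \<Oplus>k\<in>{..<n}. (inverse (of_nat n) * (q ^ k) ^ (n - i)) \<odot> g [^] k)"
    by (intro finsum_cong') (auto simp: summand Pi_def)
  also have "\<dots> = (\<Oplus>k\<in>{..<n}. \<Oplus>i\<in>{..<n}. (inverse (of_nat n) * (q ^ k) ^ (n - i)) \<odot> g [^] k)"
    by (rule finsum_swap) auto
  also have "\<dots> = (\<Oplus>k\<in>{..<n}. if 0 = k then g [^] k else \<zero>)"
  proof (rule finsum_cong')
    fix k assume k: "k \<in> {..<n}"
    have "(\<Oplus>i\<in>{..<n}. (inverse (of_nat n) * (q ^ k) ^ (n - i)) \<odot> g [^] k)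
        = (inverse (of_nat n) * (\<Sum>i<n. (q ^ k) ^ (n - i))) \<odot> g [^] k"
      by (simp add: finsum_smult sum_distrib_left)
    then show "(\<Oplus>i\<in>{..<n}. (inverse (of_nat n) * (q ^ k) ^ (n - i)) \<odot> g [^] k)
        = (if 0 = k then g [^] k else \<zero>)"
      using k n_pos by (simp add: geometric)
  qed auto
  also have "\<dots> = \<one>"
    using n_pos by (subst add.finprod_singleton) auto
  finally show ?thesis .
qed

lemma alg_iso_mat_corner_e:
  "alg_iso A (mat_algebra n (corner A e)) \<noteq> {}"
proof -
  have "(\<lambda>a. \<lambda>(i, j)\<in>{..<n} \<times> {..<n}. (e \<otimes> x [^] (n - i)) \<otimes> a \<otimes> (x [^] j \<otimes> e))
      \<in> alg_iso A (mat_algebra n (corner A e))"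
  proof (rule alg_iso_mat_corner)
    fix i j assume ij: "i < n" "j < n"
    have "(e \<otimes> x [^] (n - i)) \<otimes> (x [^] j \<otimes> e) = e \<otimes> (x [^] (n - i) \<otimes> x [^] j) \<otimes> e"
      by (simp add: m_assoc)
    also have "\<dots> = e \<otimes> x [^] (n - i + j) \<otimes> e" by (simp add: nat_pow_mult)
    also have "\<dots> = (if n dvd n - i + j then e else \<zero>)" by (rule e_x_pow_e)
    also have "n dvd n - i + j \<longleftrightarrow> i = j"
    proof
      assume "n dvd n - i + j"
      then obtain k where k: "n - i + j = n * k" by (auto elim: dvdE)
      have "n * k < n * 2" "n * k > 0" unfolding k[symmetric] using ij by auto
      then have "k = 1" by auto
      with k ij show "i = j" by auto
    qed (use ij in auto)
    finally show "(e \<otimes> x [^] (n - i)) \<otimes> (x [^] j \<otimes> e) = (if i = j then e else \<zero>)" .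
  next
    show "x [^] i \<otimes> e \<otimes> e = x [^] i \<otimes> e" for i :: nat by (simp add: m_assoc)
    show "e \<otimes> (e \<otimes> x [^] (n - i)) = e \<otimes> x [^] (n - i)" for i :: nat
      by (simp flip: m_assoc)
  qed (simp_all add: sum_x_e_x)
  then show ?thesis by blast
qed

end

section \<open>Adjoining a third generator\<close>

context clock_shift
begin

lemma g_pow_comm: "g \<otimes> g [^] k = g [^] (k::nat) \<otimes> g"
  by (metis g nat_pow_Suc nat_pow_Suc2)

lemma x_pow_g: "x [^] i \<otimes> g = inverse (q ^ i) \<odot> (g \<otimes> x [^] (i::nat))"
  by (simp add: g_x_pow)

text \<open>
  Correcting \<open>y x\<close> by a combination of \<open>g\<^sup>2\<^sup>l\<close> and \<open>1\<close> gives an element \<open>w\<close> that commutes with \<open>g\<close> and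
  satisfies \<open>w x = q\<^sup>l x w\<close>, and then \<open>z = w g\<^sup>-\<^sup>l\<close> commutes with \<open>g\<close> and \<open>x\<close>. The coefficients of the
  correction exist if \<open>q\<^sup>l \<noteq> 1\<close>. If \<open>q\<^sup>l = 1\<close>, then \<open>g\<^sup>2\<^sup>l = 1\<close> and the relation reads
  \<open>y x = x y + c\<close>. For \<open>c = 0\<close> no correction is needed; for \<open>c \<noteq> 0\<close>, commuting \<open>y\<close> past \<open>x\<^sup>n = 1\<close>
  gives \<open>n c x\<^sup>n\<^sup>-\<^sup>1 = 0\<close>, so in characteristic zero the algebra is zero.
\<close>

lemma exists_central_element:
  assumes y [simp, intro]: "y \<in> carrier A" and g_y: "g \<otimes> y = inverse q \<odot> (y \<otimes> g)"
    and y_x: "y \<otimes> x = q ^ l \<odot> (x \<otimes> y) \<oplus> (d \<odot> g [^] (2 * l) \<oplus> t \<odot> \<one>)"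
  obtains z \<alpha> \<beta> where "z \<in> carrier A" "g \<otimes> z = z \<otimes> g" "x \<otimes> z = z \<otimes> x"
    "y \<otimes> x = z \<otimes> g [^] l \<oplus> (\<alpha> \<odot> g [^] (2 * l) \<oplus> \<beta> \<odot> \<one>)"
proof -
  note result = that
  have main: thesis
    if y_x': "y \<otimes> x = q ^ l \<odot> (x \<otimes> y) \<oplus> (d' \<odot> g [^] (2 * l) \<oplus> t' \<odot> \<one>)"
      and \<alpha>: "(d' - \<alpha>) * q ^ l = - \<alpha>" and \<beta>: "t' - \<beta> = - \<beta> * q ^ l" for d' t' \<alpha> \<beta>
  proof -
    define w where "w = y \<otimes> x \<oplus> ((- \<alpha>) \<odot> g [^] (2 * l) \<oplus> (- \<beta>) \<odot> \<one>)"
    \<comment> \<open>The exponent \<open>m\<close> makes \<open>g [^] m\<close> the inverse of \<open>g [^] l\<close>.\<close>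
    define m where "m = l * (n - 1)"
    have ml: "m + l = n * l" using n_pos by (cases n) (simp_all add: m_def)
    have w [simp, intro]: "w \<in> carrier A" by (simp add: w_def)
    have "w \<otimes> x = (y \<otimes> x) \<otimes> x \<oplus> ((- \<alpha>) \<odot> (g [^] (2 * l) \<otimes> x) \<oplus> (- \<beta>) \<odot> x)"
      by (simp add: w_def l_distr)
    also have "(y \<otimes> x) \<otimes> x = q ^ l \<odot> (x \<otimes> (y \<otimes> x)) \<oplus> (d' \<odot> (g [^] (2 * l) \<otimes> x) \<oplus> t' \<odot> x)"
      by (subst y_x') (simp add: l_distr m_assoc)
    also have "q ^ l \<odot> (x \<otimes> (y \<otimes> x)) \<oplus> (d' \<odot> (g [^] (2 * l) \<otimes> x) \<oplus> t' \<odot> x)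
        \<oplus> ((- \<alpha>) \<odot> (g [^] (2 * l) \<otimes> x) \<oplus> (- \<beta>) \<odot> x)
      = q ^ l \<odot> (x \<otimes> (y \<otimes> x)) \<oplus> ((d' - \<alpha>) \<odot> (g [^] (2 * l) \<otimes> x) \<oplus> (t' - \<beta>) \<odot> x)"
    proof -
      have *: "(c - c') \<odot> a = c \<odot> a \<oplus> (- c') \<odot> a" if "a \<in> carrier A" for c c' a
        using that smult_l_distr[of a c "- c'"] by simp
      show ?thesis by (simp add: * a_ac)
    qed
    also have "g [^] (2 * l) \<otimes> x = (q ^ l * q ^ l) \<odot> (x \<otimes> g [^] (2 * l))"
      using g_pow_x_pow[of "2 * l" 1] by (simp add: mult_2 power_add)
    also have "q ^ l \<odot> (x \<otimes> (y \<otimes> x)) \<oplus> ((d' - \<alpha>) \<odot> ((q ^ l * q ^ l) \<odot> (x \<otimes> g [^] (2 * l)))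
        \<oplus> (t' - \<beta>) \<odot> x) = q ^ l \<odot> (x \<otimes> w)"
    proof -
      have "(d' - \<alpha>) * (q ^ l * q ^ l) = q ^ l * (- \<alpha>)" using \<alpha> by (simp add: mult.commute mult.assoc[symmetric])
      moreover have "t' - \<beta> = q ^ l * (- \<beta>)" using \<beta> by simp
      ultimately show ?thesis
        by (simp add: w_def r_distr smult_r_distr)
    qed
    finally have w_x: "w \<otimes> x = q ^ l \<odot> (x \<otimes> w)" .
    have "g \<otimes> (y \<otimes> x) = (g \<otimes> y) \<otimes> x" by (simp add: m_assoc)
    also have "\<dots> = inverse q \<odot> (y \<otimes> (g \<otimes> x))" by (simp add: g_y m_assoc)
    also have "\<dots> = (y \<otimes> x) \<otimes> g" by (simp add: g_x m_assoc)
    finally have g_w: "g \<otimes> w = w \<otimes> g"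
      by (simp add: w_def l_distr r_distr g_pow_comm)
    define z where "z = w \<otimes> g [^] m"
    have z: "z \<in> carrier A" by (simp add: z_def)
    have "g \<otimes> z = (g \<otimes> w) \<otimes> g [^] m" by (simp add: z_def m_assoc)
    also have "\<dots> = w \<otimes> (g \<otimes> g [^] m)" by (simp add: g_w m_assoc)
    also have "\<dots> = z \<otimes> g" by (simp add: z_def m_assoc g_pow_comm)
    finally have g_z: "g \<otimes> z = z \<otimes> g" .
    have "z \<otimes> x = w \<otimes> (g [^] m \<otimes> x)" by (simp add: z_def m_assoc)
    also have "\<dots> = q ^ m \<odot> ((w \<otimes> x) \<otimes> g [^] m)"
      using g_pow_x_pow[of m 1] by (simp add: m_assoc)
    also have "\<dots> = (q ^ m * q ^ l) \<odot> (x \<otimes> z)" by (simp add: w_x z_def m_assoc)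
    also have "q ^ m * q ^ l = 1"
      by (simp only: power_add[symmetric] ml power_mult q_n power_one)
    finally have z_x: "x \<otimes> z = z \<otimes> x" using z by simp
    have "z \<otimes> g [^] l = w \<otimes> g [^] (m + l)" by (simp add: z_def m_assoc nat_pow_mult)
    also have "\<dots> = w" by (simp add: ml g_n flip: nat_pow_pow)
    finally have zw: "z \<otimes> g [^] l = w" .
    have "y \<otimes> x = w \<oplus> (\<alpha> \<odot> g [^] (2 * l) \<oplus> \<beta> \<odot> \<one>)"
    proof -
      have *: "(- c) \<odot> a \<oplus> c \<odot> a = \<zero>" if "a \<in> carrier A" for c a
        using that by (simp add: smult_uminus l_neg)
      have "w \<oplus> (\<alpha> \<odot> g [^] (2 * l) \<oplus> \<beta> \<odot> \<one>) = y \<otimes> x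
          \<oplus> (((- \<alpha>) \<odot> g [^] (2 * l) \<oplus> \<alpha> \<odot> g [^] (2 * l)) \<oplus> ((- \<beta>) \<odot> \<one> \<oplus> \<beta> \<odot> \<one>))"
        unfolding w_def by (simp add: a_ac)
      then show ?thesis by (simp only: *[OF nat_pow_closed[OF g]] *[OF one_closed]) simp
    qed
    then show thesis using z g_z z_x by (intro result[of z \<alpha> \<beta>]) (simp_all only: zw)
  qed
  show thesis
  proof (cases "q ^ l = 1")
    case False
    show thesis
    proof (rule main[OF y_x])
      show "(d - d * q ^ l / (q ^ l - 1)) * q ^ l = - (d * q ^ l / (q ^ l - 1))"
        using False by (simp add: field_simps)
      show "t - t / (1 - q ^ l) = - (t / (1 - q ^ l)) * q ^ l"
        using False by (simp add: field_simps)
    qed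
  next
    case True
    then have "n dvd l" by (simp add: primitive_root_power_eq_1_iff[OF q])
    then have "n dvd 2 * l" by simp
    then obtain k where k: "2 * l = n * k" by (rule dvdE)
    have G: "g [^] (2 * l) = \<one>" by (simp add: k g_n flip: nat_pow_pow)
    define c where "c = d + t"
    have y_x1: "y \<otimes> x = x \<otimes> y \<oplus> c \<odot> \<one>"
      by (simp add: y_x True G c_def smult_l_distr)
    show thesis
    proof (cases "c = 0")
      case True
      then show thesis
        using y_x1 by (intro main[of 0 0 0 0]) (simp_all add: \<open>q ^ l = 1\<close>)
    next
      case False
      have y_x_pow: "y \<otimes> x [^] Suc j = x [^] Suc j \<otimes> y \<oplus> (of_nat (Suc j) * c) \<odot> x [^] j" for j
      proof (induction j)
        case (Suc j)
        have "y \<otimes> x [^] Suc (Suc j) = (y \<otimes> x [^] Suc j) \<otimes> x" by (simp add: m_assoc)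
        also have "\<dots> = x [^] Suc j \<otimes> (y \<otimes> x) \<oplus> (of_nat (Suc j) * c) \<odot> x [^] Suc j"
          by (subst Suc) (simp add: l_distr m_assoc)
        also have "x [^] Suc j \<otimes> (y \<otimes> x) = x [^] Suc (Suc j) \<otimes> y \<oplus> c \<odot> x [^] Suc j"
          by (subst y_x1) (simp add: r_distr m_assoc)
        also have "x [^] Suc (Suc j) \<otimes> y \<oplus> c \<odot> x [^] Suc j \<oplus> (of_nat (Suc j) * c) \<odot> x [^] Suc j
            = x [^] Suc (Suc j) \<otimes> y \<oplus> (c + of_nat (Suc j) * c) \<odot> x [^] Suc j"
          by (subst smult_l_distr) (simp_all add: a_assoc)
        also have "c + of_nat (Suc j) * c = of_nat (Suc (Suc j)) * c"
          by (simp add: algebra_simps)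
        finally show ?case .
      qed (simp add: y_x1)
      obtain j where j: "n = Suc j" using n_pos gr0_implies_Suc by blast
      have "y \<oplus> (of_nat n * c) \<odot> x [^] j = y"
        using y_x_pow[of j] x_n unfolding j[symmetric] by (simp del: nat_pow_Suc)
      then have "(of_nat n * c) \<odot> x [^] j = \<zero>"
        by (simp add: add.r_cancel_one)
      then have "x [^] j = \<zero>" using False n_pos smult_cancel[of "x [^] j" "of_nat n * c"] by simp
      then have "\<one> = \<zero>" using x_n by (simp add: j)
      then have triv: "a = \<zero>" if "a \<in> carrier A" for a using that by (metis l_null l_one)
      show thesis
      proof (rule result)
        show "\<zero> \<in> carrier A" "g \<otimes> \<zero> = \<zero> \<otimes> g" "x \<otimes> \<zero> = \<zero> \<otimes> x" by simp_all
        show "y \<otimes> x = \<zero> \<otimes> g [^] l \<oplus> (0 \<odot> g [^] (2 * l) \<oplus> 0 \<odot> \<one>)"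
          using triv[of "y \<otimes> x"] by simp
      qed
    qed
  qed
qed

text \<open>
  Since \<open>e x\<^sup>i g\<^sup>k z\<^sup>j e\<close> is \<open>z\<^sup>j e\<close> or zero, the corner at \<open>e\<close> is generated by \<open>z e\<close>. The relation for
  \<open>y x\<close> shows that \<open>y\<^sup>j x\<^sup>j e\<close> is a product of \<open>j\<close> linear polynomials in \<open>z e\<close>; for \<open>j = n\<close> this is a
  scalar, and the resulting equation for \<open>z e\<close> is nontrivial because it has degree \<open>n > 0\<close>.
\<close>

lemma corner_polynomial:
  fixes l :: nat
  assumes y [simp, intro]: "y \<in> carrier A" and z [simp, intro]: "z \<in> carrier A"
    and g_z: "g \<otimes> z = z \<otimes> g" and x_z: "x \<otimes> z = z \<otimes> x"
    and y_x: "y \<otimes> x = z \<otimes> g [^] l \<oplus> (\<alpha> \<odot> g [^] (2 * l) \<oplus> \<beta> \<odot> \<one>)"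
    and y_n: "y [^] n = b \<odot> \<one>"
    and gen: "\<And>S. \<one> \<in> S \<Longrightarrow> (\<And>a. a \<in> S \<Longrightarrow> g \<otimes> a \<in> S) \<Longrightarrow> (\<And>a. a \<in> S \<Longrightarrow> x \<otimes> a \<in> S)
      \<Longrightarrow> (\<And>a. a \<in> S \<Longrightarrow> y \<otimes> a \<in> S) \<Longrightarrow> (\<And>c a. a \<in> S \<Longrightarrow> c \<odot> a \<in> S)
      \<Longrightarrow> (\<And>a b. a \<in> S \<Longrightarrow> b \<in> S \<Longrightarrow> a \<oplus> b \<in> S) \<Longrightarrow> carrier A \<subseteq> S"
  shows "z \<otimes> e \<in> carrier (corner A e)"
    and "carrier (corner A e) = range (poly_ev (corner A e) (z \<otimes> e))"
    and "\<exists>p. p \<noteq> 0 \<and> poly_ev (corner A e) (z \<otimes> e) p = \<zero>"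
proof -
  let ?ev = "poly_ev (corner A e) (z \<otimes> e)"
  interpret R: assoc_algebra "corner A e" by (rule corner_algebra) simp_all
  have g_pow_z: "g [^] k \<otimes> z = z \<otimes> g [^] k" for k :: nat
    by (induction k) (simp_all add: m_assoc g_z, simp add: m_assoc[symmetric])
  have x_pow_z: "x [^] k \<otimes> z = z \<otimes> x [^] k" for k :: nat
    by (induction k) (simp_all add: m_assoc x_z, simp add: m_assoc[symmetric])
  have e_z: "e \<otimes> z = z \<otimes> e"
    by (simp add: e_def finsum_ldistr finsum_rdistr Pi_def g_pow_z)
  show \<zeta>: "z \<otimes> e \<in> carrier (corner A e)"
  proof -
    have "e \<otimes> (z \<otimes> e) = (e \<otimes> z) \<otimes> e" by (simp add: m_assoc)
    then show ?thesis by (simp add: e_z m_assoc)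
  qed
  note ev = R.ev_0[OF \<zeta>] R.ev_add[OF \<zeta>] R.ev_smult[OF \<zeta>] R.ev_mult[OF \<zeta>] R.ev_1[OF \<zeta>]
    R.ev_pCons[OF \<zeta>]
  have ev_c [simp]: "?ev p \<in> carrier A" and e_ev [simp]: "e \<otimes> ?ev p = ?ev p" for p
    using R.ev_closed[OF \<zeta>, of p] by simp_all
  define D where "D = range ?ev"
  \<comment> \<open>The set \<open>S\<close> is shown to be closed under left multiplication by the generators.\<close>
  define S where "S = {a \<in> carrier A. \<forall>i. e \<otimes> (x [^] (i::nat) \<otimes> (a \<otimes> e)) \<in> D}"
  have S_g: "g \<otimes> a \<in> S" if "a \<in> S" for a
  proof -
    have a [simp]: "a \<in> carrier A" using that by (simp add: S_def)
    have "e \<otimes> (x [^] i \<otimes> (g \<otimes> a \<otimes> e)) \<in> D" for i :: nat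
    proof -
      have "e \<otimes> (x [^] i \<otimes> (g \<otimes> a \<otimes> e)) = e \<otimes> ((x [^] i \<otimes> g) \<otimes> (a \<otimes> e))"
        by (simp add: m_assoc)
      also have "\<dots> = inverse (q ^ i) \<odot> ((e \<otimes> g) \<otimes> (x [^] i \<otimes> (a \<otimes> e)))"
        unfolding x_pow_g by (simp add: m_assoc del: e_g)
      also have "\<dots> = inverse (q ^ i) \<odot> (e \<otimes> (x [^] i \<otimes> (a \<otimes> e)))" by simp
      also obtain p where "e \<otimes> (x [^] i \<otimes> (a \<otimes> e)) = ?ev p"
        using \<open>a \<in> S\<close> unfolding S_def D_def by blast
      also have "inverse (q ^ i) \<odot> ?ev p = ?ev (Polynomial.smult (inverse (q ^ i)) p)"
        by (simp add: ev)
      finally show ?thesis by (simp add: D_def)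
    qed
    then show ?thesis by (simp add: S_def)
  qed
  have S_x: "x \<otimes> a \<in> S" if "a \<in> S" for a
  proof -
    have a [simp]: "a \<in> carrier A" using that by (simp add: S_def)
    have "e \<otimes> (x [^] i \<otimes> (x \<otimes> a \<otimes> e)) \<in> D" for i :: nat
    proof -
      have "e \<otimes> (x [^] i \<otimes> (x \<otimes> a \<otimes> e)) = e \<otimes> (x [^] Suc i \<otimes> (a \<otimes> e))"
        by (simp add: m_assoc)
      also have "\<dots> \<in> D" using \<open>a \<in> S\<close> unfolding S_def by blast
      finally show ?thesis .
    qed
    then show ?thesis by (simp add: S_def)
  qed
  have S_z: "z \<otimes> a \<in> S" if "a \<in> S" for a
  proof -
    have a [simp]: "a \<in> carrier A" using that by (simp add: S_def)
    have "e \<otimes> (x [^] i \<otimes> (z \<otimes> a \<otimes> e)) \<in> D" for i :: nat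
    proof -
      have "e \<otimes> (x [^] i \<otimes> (z \<otimes> a \<otimes> e)) = e \<otimes> ((x [^] i \<otimes> z) \<otimes> (a \<otimes> e))"
        by (simp add: m_assoc)
      also have "\<dots> = (e \<otimes> z) \<otimes> (x [^] i \<otimes> (a \<otimes> e))" by (simp add: x_pow_z m_assoc)
      also have "\<dots> = z \<otimes> (e \<otimes> (x [^] i \<otimes> (a \<otimes> e)))" by (simp add: e_z m_assoc)
      also obtain p where "e \<otimes> (x [^] i \<otimes> (a \<otimes> e)) = ?ev p"
        using \<open>a \<in> S\<close> unfolding S_def D_def by blast
      also have "z \<otimes> ?ev p = (z \<otimes> e) \<otimes> ?ev p" by (simp add: m_assoc)
      also have "\<dots> = ?ev (pCons 0 p)"
        by (simp add: ev)
      finally show ?thesis by (simp add: D_def)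
    qed
    then show ?thesis by (simp add: S_def)
  qed
  have S_smult: "c \<odot> a \<in> S" if "a \<in> S" for c a
  proof -
    have a [simp]: "a \<in> carrier A" using that by (simp add: S_def)
    have "e \<otimes> (x [^] i \<otimes> (c \<odot> a \<otimes> e)) \<in> D" for i :: nat
    proof -
      obtain p where p: "e \<otimes> (x [^] i \<otimes> (a \<otimes> e)) = ?ev p"
        using \<open>a \<in> S\<close> unfolding S_def D_def by blast
      have "e \<otimes> (x [^] i \<otimes> (c \<odot> a \<otimes> e)) = ?ev (Polynomial.smult c p)"
        by (simp add: ev p)
      then show ?thesis by (simp add: D_def)
    qed
    then show ?thesis by (simp add: S_def)
  qed
  have S_add: "a \<oplus> a' \<in> S" if "a \<in> S" "a' \<in> S" for a a'
  proof -
    have a [simp]: "a \<in> carrier A" "a' \<in> carrier A" using that by (simp_all add: S_def)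
    have "e \<otimes> (x [^] i \<otimes> ((a \<oplus> a') \<otimes> e)) \<in> D" for i :: nat
    proof -
      obtain p p' where p: "e \<otimes> (x [^] i \<otimes> (a \<otimes> e)) = ?ev p" "e \<otimes> (x [^] i \<otimes> (a' \<otimes> e)) = ?ev p'"
        using \<open>a \<in> S\<close> \<open>a' \<in> S\<close> unfolding S_def D_def by blast
      have "e \<otimes> (x [^] i \<otimes> ((a \<oplus> a') \<otimes> e)) = ?ev (p + p')"
        by (simp add: ev p l_distr r_distr)
      then show ?thesis by (simp add: D_def)
    qed
    then show ?thesis by (simp add: S_def)
  qed
  have S_1: "\<one> \<in> S"
  proof -
    have "e \<otimes> (x [^] i \<otimes> (\<one> \<otimes> e)) = ?ev (if n dvd i then 1 else 0)" for i
      using e_x_pow_e[of i] by (simp add: ev m_assoc)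
    then show ?thesis by (simp add: S_def D_def)
  qed
  have S_carrier: "a \<in> carrier A" if "a \<in> S" for a using that by (simp add: S_def)
  have S_g_pow: "g [^] k \<otimes> a \<in> S" if "a \<in> S" for a and k :: nat
  proof (induction k)
    case (Suc k)
    have "g [^] Suc k \<otimes> a = g \<otimes> (g [^] k \<otimes> a)"
      unfolding nat_pow_Suc2[OF g] using S_carrier[OF that] by (simp add: m_assoc)
    then show ?case using S_g[OF Suc] by simp
  qed (use that S_carrier in simp)
  have S_x_pow: "x [^] k \<otimes> a \<in> S" if "a \<in> S" for a and k :: nat
  proof (induction k)
    case (Suc k)
    have "x [^] Suc k \<otimes> a = x \<otimes> (x [^] k \<otimes> a)"
      unfolding nat_pow_Suc2[OF x] using S_carrier[OF that] by (simp add: m_assoc)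
    then show ?case using S_x[OF Suc] by simp
  qed (use that S_carrier in simp)
  have S_y: "y \<otimes> a \<in> S" if "a \<in> S" for a
  proof -
    obtain j where j: "n = Suc j" using n_pos gr0_implies_Suc by blast
    let ?a = "x [^] j \<otimes> a"
    note [simp] = S_carrier[OF that]
    \<comment> \<open>Here \<open>x [^] j\<close> is the inverse of \<open>x\<close>, so \<open>y = (y x) x [^] j\<close> is expressed by \<open>g\<close>, \<open>x\<close> and \<open>z\<close>.\<close>
    have "y \<otimes> a = (y \<otimes> x) \<otimes> ?a"
    proof -
      have "x \<otimes> x [^] j = \<one>" using x_n by (simp only: j nat_pow_Suc2[OF x])
      then have "a = x \<otimes> ?a" by (simp flip: m_assoc)
      then show ?thesis by (metis S_carrier m_assoc m_closed nat_pow_closed that x y)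
    qed
    also have "\<dots> = z \<otimes> (g [^] l \<otimes> ?a) \<oplus> (\<alpha> \<odot> (g [^] (2 * l) \<otimes> ?a) \<oplus> \<beta> \<odot> ?a)"
      unfolding y_x by (simp add: l_distr m_assoc)
    finally show ?thesis
      using S_add S_smult S_z S_g_pow S_x_pow that by metis
  qed
  have "carrier A \<subseteq> S"
    by (rule gen) (fact S_1 S_g S_x S_y S_smult S_add)+
  then have "e \<otimes> (x [^] (0::nat) \<otimes> (a \<otimes> e)) \<in> D" if "a \<in> carrier A" for a
    using that unfolding S_def by blast
  then have "a \<in> D" if "a \<in> carrier (corner A e)" for a using that by fastforce
  then show "carrier (corner A e) = range ?ev"
    using R.ev_closed[OF \<zeta>] unfolding D_def by blast

  define L where "L i = [:\<alpha> * (q ^ (2 * l)) ^ i + \<beta>, (q ^ l) ^ i:]" for i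
  have yx_e: "(y \<otimes> x) \<otimes> (x [^] i \<otimes> e) = x [^] i \<otimes> ?ev (L i)" for i :: nat
  proof -
    have g_pow: "g [^] k \<otimes> (x [^] i \<otimes> e) = (q ^ k) ^ i \<odot> (x [^] i \<otimes> e)" for k :: nat
    proof -
      have "g [^] k \<otimes> (x [^] i \<otimes> e) = (g [^] k \<otimes> x [^] i) \<otimes> e" by (simp add: m_assoc)
      then show ?thesis by (simp add: g_pow_x_pow m_assoc power_mult)
    qed
    have z_x: "z \<otimes> (x [^] i \<otimes> e) = x [^] i \<otimes> (z \<otimes> e)"
    proof -
      have "z \<otimes> (x [^] i \<otimes> e) = (z \<otimes> x [^] i) \<otimes> e" by (simp add: m_assoc)
      then show ?thesis by (simp add: m_assoc flip: x_pow_z)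
    qed
    have "(y \<otimes> x) \<otimes> (x [^] i \<otimes> e) = z \<otimes> (g [^] l \<otimes> (x [^] i \<otimes> e))
        \<oplus> (\<alpha> \<odot> (g [^] (2 * l) \<otimes> (x [^] i \<otimes> e)) \<oplus> \<beta> \<odot> (x [^] i \<otimes> e))"
      unfolding y_x by (simp add: l_distr m_assoc)
    also have "\<dots> = (q ^ l) ^ i \<odot> (x [^] i \<otimes> (z \<otimes> e))
        \<oplus> (\<alpha> * (q ^ (2 * l)) ^ i + \<beta>) \<odot> (x [^] i \<otimes> e)"
      by (simp add: g_pow z_x smult_l_distr)
    also have "\<dots> = x [^] i \<otimes> ?ev (L i)"
    proof -
      have "?ev (L i) = (\<alpha> * (q ^ (2 * l)) ^ i + \<beta>) \<odot> e \<oplus> (q ^ l) ^ i \<odot> (z \<otimes> e)"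
        unfolding L_def by (simp add: ev m_assoc)
      then show ?thesis by (simp add: r_distr a_comm)
    qed
    finally show ?thesis .
  qed
  have y_x_e: "y [^] j \<otimes> (x [^] j \<otimes> e) = ?ev (\<Prod>i<j. L i)" for j :: nat
  proof (induction j)
    case (Suc j)
    have "y [^] Suc j \<otimes> (x [^] Suc j \<otimes> e) = y [^] j \<otimes> ((y \<otimes> x) \<otimes> (x [^] j \<otimes> e))"
      unfolding nat_pow_Suc[of y] nat_pow_Suc2[OF x] by (simp add: m_assoc)
    also have "\<dots> = y [^] j \<otimes> (x [^] j \<otimes> (e \<otimes> ?ev (L j)))" by (simp add: yx_e)
    also have "\<dots> = (y [^] j \<otimes> (x [^] j \<otimes> e)) \<otimes> ?ev (L j)"
      by (simp only: m_assoc nat_pow_closed m_closed y x e_closed ev_c)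
    also have "\<dots> = ?ev (\<Prod>i<Suc j. L i)" by (simp add: Suc ev)
    finally show ?case .
  qed (simp add: ev)
  define p where "p = (\<Prod>i<n. L i) - [:b:]"
  have "?ev (\<Prod>i<n. L i) = b \<odot> e" using y_x_e[of n] by (simp add: y_n x_n)
  moreover have "?ev [:b:] = b \<odot> e" by (simp add: ev)
  ultimately have "?ev p = \<zero>" unfolding p_def R.ev_diff[OF \<zeta>]
    using R.r_neg[of "b \<odot> e"] by (simp add: a_minus_def R.minus_eq)
  moreover have "p \<noteq> 0"
  proof
    assume "p = 0"
    then have "degree (\<Prod>i<n. L i) = 0" by (simp add: p_def)
    moreover have "degree (\<Prod>i<n. L i) = (\<Sum>i<n. degree (L i))"
      by (rule degree_prod_eq_sum_degree) (simp add: L_def)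
    moreover have "degree (L i) = 1" for i by (simp add: L_def)
    ultimately show False using n_pos by simp
  qed
  ultimately show "\<exists>p. p \<noteq> 0 \<and> ?ev p = \<zero>" by blast
qed

end

section \<open>The direct summands\<close>

text \<open>
  The algebra \<open>A\<close> is isomorphic to a finite direct sum of matrix algebras of size \<open>n\<close> over commutative
  local algebras. The local algebras are realised on the element type of \<open>A\<close>, which is enough for
  corners of \<open>A\<close>. The zero algebra is the empty sum.
\<close>

definition splits_into_local_matrix_algebras :: "nat \<Rightarrow> ('k::field, 'a) module \<Rightarrow> bool" where
  "splits_into_local_matrix_algebras n A \<longleftrightarrow> (\<exists>Rs :: ('k, 'a) module list.
     (\<forall>R\<in>set Rs. algebra (ring_of_type_algebra :: 'k ring) R \<and> local_cring R) \<and>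
     alg_iso A (direct_sum_algebra (map (mat_algebra n) Rs)) \<noteq> {})"

lemma splits_of_mat_monogenic:
  fixes A R :: "('k::alg_closed_field, 'a) module"
  assumes iso: "alg_iso A (mat_algebra n R) \<noteq> {}"
    and "assoc_algebra R" and z: "z \<in> carrier R" and gen: "carrier R = range (poly_ev R z)"
    and p: "p \<noteq> 0" "poly_ev R z p = \<zero>\<^bsub>R\<^esub>"
  shows "splits_into_local_matrix_algebras n A"
proof -
  interpret R: assoc_algebra R by fact
  have comm: "a \<otimes>\<^bsub>R\<^esub> b = b \<otimes>\<^bsub>R\<^esub> a" if "a \<in> carrier R" "b \<in> carrier R" for a b
    using that R.ev_commute[OF z] by (auto simp: gen)
  obtain fs where fs: "\<And>f. f \<in> set fs \<Longrightarrow> f \<in> carrier R \<and> f \<otimes>\<^bsub>R\<^esub> f = f \<and> local_cring (corner R f)"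
    and orth: "\<And>i j. i < length fs \<Longrightarrow> j < length fs \<Longrightarrow> i \<noteq> j \<Longrightarrow> fs ! i \<otimes>\<^bsub>R\<^esub> fs ! j = \<zero>\<^bsub>R\<^esub>"
    and sum: "(\<Oplus>\<^bsub>R\<^esub>i\<in>{..<length fs}. fs ! i) = \<one>\<^bsub>R\<^esub>"
    using local_decomposition[OF assms(2) z gen p] by blast
  from iso obtain h where h: "h \<in> alg_iso A (mat_algebra n R)" by blast
  have "algebra (ring_of_type_algebra :: 'k ring) (corner R f) \<and> local_cring (corner R f)"
    if "f \<in> set fs" for f
  proof -
    interpret C: assoc_algebra "corner R f"
      using fs[OF that] by (intro R.corner_algebra) auto
    show ?thesis using fs[OF that] comm by (auto intro!: C.algebra_of_commutative)
  qed
  moreover have "alg_iso A (direct_sum_algebra (map (mat_algebra n) (map (corner R) fs))) \<noteq> {}"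
    using alg_iso_trans[OF h R.alg_iso_mat_direct_sum[OF comm _ _ orth sum]] fs by blast
  ultimately show ?thesis
    unfolding splits_into_local_matrix_algebras_def by (intro exI[of _ "map (corner R) fs"]) auto
qed

lemma (in assoc_algebra) smult_nat_pow:
  assumes [simp]: "a \<in> carrier A"
  shows "(c \<odot> a) [^] (n :: nat) = c ^ n \<odot> a [^] n"
  by (induction n) (simp_all add: mult.commute)

text \<open>
  The hypothesis \<open>gen\<close> says that \<open>g\<close>, \<open>x\<close>, \<open>y\<close> generate \<open>A\<close>. Scaling \<open>x\<close> by an \<open>n\<close>-th root of
  \<open>b1\<close> makes \<open>g\<close> and \<open>x\<close> clock and shift elements.
\<close>

lemma splits_of_relations:
  fixes A :: "('k::{alg_closed_field, field_char_0}, 'a) module" (structure) and n l :: nat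
  assumes "assoc_algebra A" and q: "primitive_root_of_unity n q"
    and [simp]: "g \<in> carrier A" "x \<in> carrier A" "y \<in> carrier A"
    and g_n: "g [^] n = \<one>" and x_n: "x [^] n = b1 \<odot> \<one>" and "b1 \<noteq> 0" and y_n: "y [^] n = b2 \<odot> \<one>"
    and g_x: "g \<otimes> x = q \<odot> (x \<otimes> g)" and g_y: "g \<otimes> y = inverse q \<odot> (y \<otimes> g)"
    and y_x: "y \<otimes> x = q ^ l \<odot> (x \<otimes> y) \<oplus> (d \<odot> g [^] (2 * l) \<oplus> t \<odot> \<one>)"
    and gen: "\<And>S. \<one> \<in> S \<Longrightarrow> (\<And>a. a \<in> S \<Longrightarrow> g \<otimes> a \<in> S) \<Longrightarrow> (\<And>a. a \<in> S \<Longrightarrow> x \<otimes> a \<in> S)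
      \<Longrightarrow> (\<And>a. a \<in> S \<Longrightarrow> y \<otimes> a \<in> S) \<Longrightarrow> (\<And>c a. a \<in> S \<Longrightarrow> c \<odot> a \<in> S)
      \<Longrightarrow> (\<And>a b. a \<in> S \<Longrightarrow> b \<in> S \<Longrightarrow> a \<oplus> b \<in> S) \<Longrightarrow> carrier A \<subseteq> S"
  shows "splits_into_local_matrix_algebras n A"
proof -
  interpret assoc_algebra A by fact
  have "n > 0" using q by (simp add: primitive_root_of_unity_def)
  then obtain \<xi> where \<xi>: "\<xi> ^ n = b1" using nth_root_exists by blast
  with \<open>b1 \<noteq> 0\<close> \<open>n > 0\<close> have "\<xi> \<noteq> 0" by (auto simp: power_0_left)
  define x' where "x' = inverse \<xi> \<odot> x"
  have x': "x' \<in> carrier A" by (simp add: x'_def)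
  interpret clock_shift A n q g x'
  proof
    show "x' [^] n = \<one>"
      using \<open>b1 \<noteq> 0\<close> by (simp add: x'_def smult_nat_pow x_n power_inverse \<xi>)
    show "g \<otimes> x' = q \<odot> (x' \<otimes> g)" by (simp add: x'_def g_x mult.commute)
  qed (simp_all add: q g_n x')
  have "y \<otimes> x' = q ^ l \<odot> (x' \<otimes> y) \<oplus> ((inverse \<xi> * d) \<odot> g [^] (2 * l) \<oplus> (inverse \<xi> * t) \<odot> \<one>)"
    by (simp add: x'_def y_x smult_r_distr mult.commute)
  from exists_central_element[OF assms(5) g_y this] obtain z \<alpha> \<beta> where
    z: "z \<in> carrier A" "g \<otimes> z = z \<otimes> g" "x' \<otimes> z = z \<otimes> x'"
      "y \<otimes> x' = z \<otimes> g [^] l \<oplus> (\<alpha> \<odot> g [^] (2 * l) \<oplus> \<beta> \<odot> \<one>)" .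
  have gen': "carrier A \<subseteq> S"
    if S: "\<one> \<in> S" "\<And>a. a \<in> S \<Longrightarrow> g \<otimes> a \<in> S" "\<And>a. a \<in> S \<Longrightarrow> x' \<otimes> a \<in> S"
      "\<And>a. a \<in> S \<Longrightarrow> y \<otimes> a \<in> S" "\<And>c a. a \<in> S \<Longrightarrow> c \<odot> a \<in> S"
      "\<And>a b. a \<in> S \<Longrightarrow> b \<in> S \<Longrightarrow> a \<oplus> b \<in> S" for S
  proof -
    have S_x: "x \<otimes> a \<in> S \<inter> carrier A" if "a \<in> S \<inter> carrier A" for a
    proof -
      have "x \<otimes> a = \<xi> \<odot> (x' \<otimes> a)" using that \<open>\<xi> \<noteq> 0\<close> by (simp add: x'_def)
      moreover have "x' \<otimes> a \<in> S" using that by (simp add: S(3))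
      ultimately show ?thesis using that by (simp add: S(5))
    qed
    have "carrier A \<subseteq> S \<inter> carrier A"
      by (rule gen) (simp_all add: S S_x[unfolded Int_iff])
    then show ?thesis by blast
  qed
  have corner: "z \<otimes> e \<in> carrier (corner A e)"
    "carrier (corner A e) = range (poly_ev (corner A e) (z \<otimes> e))"
    "\<exists>p. p \<noteq> 0 \<and> poly_ev (corner A e) (z \<otimes> e) p = \<zero>"
    by (rule corner_polynomial[OF assms(5) z y_n], fact gen')+
  obtain p where p: "p \<noteq> 0" "poly_ev (corner A e) (z \<otimes> e) p = \<zero>\<^bsub>corner A e\<^esub>"
    using corner(3) by auto
  show ?thesis
    by (rule splits_of_mat_monogenic[OF alg_iso_mat_corner_e corner_algebra[OF e_closed e_idem]
          corner(1,2) p])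
qed

text \<open>
  The relations are symmetric under exchanging \<open>x\<close> with \<open>y\<close> and \<open>q\<close> with its inverse, which reduces
  the case \<open>b2 \<noteq> 0\<close> to that of an invertible \<open>x\<close>. With \<open>g x = q\<^sup>-\<^sup>1 x g\<close> the root of unity of the
  clock and shift pair is \<open>q\<^sup>-\<^sup>1\<close> when \<open>x\<close> is the shift, and \<open>q\<close> when \<open>y\<close> is.
\<close>

lemma summand_algebra_splits:
  fixes q b1 b2 b3 c :: "'k :: {alg_closed_field, field_char_0}"
  assumes q: "primitive_root_of_unity n q" and b: "b1 \<noteq> 0 \<or> b2 \<noteq> 0"
  shows "splits_into_local_matrix_algebras n (summand_algebra n l q b1 b2 b3 c)"
proof -
  define rels where "rels = summand_rels n l q b1 b2 b3 c"
  define A where "A = presented_algebra rels"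
  interpret assoc_algebra A unfolding A_def by (rule presented_algebra)
  define g x y where "g = residue rels (var Gg)" and "x = residue rels (var Gx)"
    and "y = residue rels (var Gy)"
  define d t where "d = (if b3 = 0 then 0 else 1 :: 'k)" and "t = (if b3 = 0 then 0 else - c)"
  have [simp]: "g \<in> carrier A" "x \<in> carrier A" "y \<in> carrier A"
    by (simp_all add: g_def x_def y_def A_def residue_closed)
  have "q \<noteq> 0" using q by (auto simp: primitive_root_of_unity_def power_0_left)
  have rels:
    "var Gg ^ n - 1 \<in> rels" "var Gx ^ n - scal b1 \<in> rels" "var Gy ^ n - scal b2 \<in> rels"
    "var Gg * var Gx - scal (inverse q) * var Gx * var Gg \<in> rels"
    "var Gg * var Gy - scal q * var Gy * var Gg \<in> rels"
    "(var Gy * var Gx - scal (q powi (- int l)) * var Gx * var Gy)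
       - (if b3 = 0 then 0 else var Gg ^ (2 * l) - scal c) \<in> rels"
    by (simp_all add: rels_def summand_rels_def Let_def)
  note res = presented_algebra(3-6)[of rels, folded A_def] residue_pow[of rels, folded A_def]
    residue_scal[of rels, folded A_def] residue_0[of rels, folded A_def]
    g_def[symmetric] x_def[symmetric] y_def[symmetric]
  have g_n: "g [^]\<^bsub>A\<^esub> n = \<one>\<^bsub>A\<^esub>"
    using residue_eqI[OF rels(1)] by (simp add: res)
  have x_n: "x [^]\<^bsub>A\<^esub> n = b1 \<odot>\<^bsub>A\<^esub> \<one>\<^bsub>A\<^esub>"
    using residue_eqI[OF rels(2)] by (simp add: res)
  have y_n: "y [^]\<^bsub>A\<^esub> n = b2 \<odot>\<^bsub>A\<^esub> \<one>\<^bsub>A\<^esub>"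
    using residue_eqI[OF rels(3)] by (simp add: res)
  have g_x: "g \<otimes>\<^bsub>A\<^esub> x = inverse q \<odot>\<^bsub>A\<^esub> (x \<otimes>\<^bsub>A\<^esub> g)"
    using residue_eqI[OF rels(4)] by (simp add: res mult.assoc)
  have g_y: "g \<otimes>\<^bsub>A\<^esub> y = q \<odot>\<^bsub>A\<^esub> (y \<otimes>\<^bsub>A\<^esub> g)"
    using residue_eqI[OF rels(5)] by (simp add: res mult.assoc)
  have y_x: "y \<otimes>\<^bsub>A\<^esub> x = inverse q ^ l \<odot>\<^bsub>A\<^esub> (x \<otimes>\<^bsub>A\<^esub> y)
      \<oplus>\<^bsub>A\<^esub> (d \<odot>\<^bsub>A\<^esub> g [^]\<^bsub>A\<^esub> (2 * l) \<oplus>\<^bsub>A\<^esub> t \<odot>\<^bsub>A\<^esub> \<one>\<^bsub>A\<^esub>)"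
  proof -
    let ?r = "q powi (- int l)"
    let ?c = "if b3 = 0 then 0 else var Gg ^ (2 * l) - scal c"
    have r: "?r = inverse q ^ l" by (simp add: power_int_minus power_inverse)
    have "residue rels (var Gy * var Gx - scal ?r * var Gx * var Gy) = residue rels ?c"
      by (rule residue_eqI[OF rels(6)])
    then have "residue rels (scal ?r * (var Gx * var Gy))
        \<oplus>\<^bsub>A\<^esub> residue rels (var Gy * var Gx - scal ?r * var Gx * var Gy)
      = residue rels (scal ?r * (var Gx * var Gy)) \<oplus>\<^bsub>A\<^esub> residue rels ?c" by simp
    moreover have "residue rels (scal ?r * (var Gx * var Gy))
        \<oplus>\<^bsub>A\<^esub> residue rels (var Gy * var Gx - scal ?r * var Gx * var Gy) = y \<otimes>\<^bsub>A\<^esub> x"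
      by (subst res(2)[symmetric]) (simp add: mult.assoc res)
    moreover have "?c = scal d * var Gg ^ (2 * l) + scal t"
      by (simp add: d_def t_def scal_def single_uminus)
    ultimately show ?thesis by (simp only: res r) simp
  qed
  have gen: "carrier A \<subseteq> S"
    if S: "\<one>\<^bsub>A\<^esub> \<in> S" "\<And>a. a \<in> S \<Longrightarrow> g \<otimes>\<^bsub>A\<^esub> a \<in> S" "\<And>a. a \<in> S \<Longrightarrow> x \<otimes>\<^bsub>A\<^esub> a \<in> S"
      "\<And>a. a \<in> S \<Longrightarrow> y \<otimes>\<^bsub>A\<^esub> a \<in> S" "\<And>c a. a \<in> S \<Longrightarrow> c \<odot>\<^bsub>A\<^esub> a \<in> S"
      "\<And>a b. a \<in> S \<Longrightarrow> b \<in> S \<Longrightarrow> a \<oplus>\<^bsub>A\<^esub> b \<in> S" for S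
  proof
    fix a assume "a \<in> carrier A"
    then show "a \<in> S" unfolding A_def
    proof (induction a rule: presented_algebra_induct)
      case (gen s a)
      then show ?case using S(2-4) by (cases s) (simp_all add: A_def g_def x_def y_def)
    qed (use S in \<open>simp_all add: A_def\<close>)
  qed
  have "splits_into_local_matrix_algebras n A"
  proof (cases "b1 = 0")
    case False
    show ?thesis
    proof (rule splits_of_relations[of A n "inverse q" g x y b1 b2 l d t])
      show "primitive_root_of_unity n (inverse q)"
        using q by (rule primitive_root_of_unity_inverse)
      show "g \<otimes>\<^bsub>A\<^esub> y = inverse (inverse q) \<odot>\<^bsub>A\<^esub> (y \<otimes>\<^bsub>A\<^esub> g)" by (simp add: g_y)
    qed (use False assoc_algebra_axioms g_n x_n y_n g_x y_x gen in simp_all)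
  next
    case True
    with b have "b2 \<noteq> 0" by simp
    have x_y: "x \<otimes>\<^bsub>A\<^esub> y = q ^ l \<odot>\<^bsub>A\<^esub> (y \<otimes>\<^bsub>A\<^esub> x)
        \<oplus>\<^bsub>A\<^esub> ((- (q ^ l) * d) \<odot>\<^bsub>A\<^esub> g [^]\<^bsub>A\<^esub> (2 * l) \<oplus>\<^bsub>A\<^esub> (- (q ^ l) * t) \<odot>\<^bsub>A\<^esub> \<one>\<^bsub>A\<^esub>)"
    proof -
      let ?c = "d \<odot>\<^bsub>A\<^esub> g [^]\<^bsub>A\<^esub> (2 * l) \<oplus>\<^bsub>A\<^esub> t \<odot>\<^bsub>A\<^esub> \<one>\<^bsub>A\<^esub>"
      have "q ^ l \<odot>\<^bsub>A\<^esub> (y \<otimes>\<^bsub>A\<^esub> x) = x \<otimes>\<^bsub>A\<^esub> y \<oplus>\<^bsub>A\<^esub> q ^ l \<odot>\<^bsub>A\<^esub> ?c"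
        using \<open>q \<noteq> 0\<close> by (subst y_x) (simp add: smult_r_distr flip: power_mult_distrib)
      then have "q ^ l \<odot>\<^bsub>A\<^esub> (y \<otimes>\<^bsub>A\<^esub> x) \<oplus>\<^bsub>A\<^esub> (- (q ^ l)) \<odot>\<^bsub>A\<^esub> ?c = x \<otimes>\<^bsub>A\<^esub> y"
        by (simp add: a_assoc smult_uminus r_neg)
      then show ?thesis by (simp add: smult_r_distr)
    qed
    show ?thesis
    proof (rule splits_of_relations[of A n q g y x b2 b1 l "- (q ^ l) * d" "- (q ^ l) * t"])
    qed (use \<open>b2 \<noteq> 0\<close> q assoc_algebra_axioms g_n x_n y_n g_x g_y x_y gen in simp_all)
  qed
  then show ?thesis by (simp add: summand_algebra_def A_def rels_def)
qed

theorem lemma3p6: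
  fixes q \<omega> \<omega>0 \<beta>1 \<beta>2 \<beta>3 \<beta>1' \<beta>2' :: "'k :: {alg_closed_field, field_char_0}"
    and n m N n1 n2 n3 i :: nat
  assumes "n \<ge> 2" and "primitive_root_of_unity n q"
    and "m \<ge> 1" and "N = m * n * (n - 1)"
    and "1 \<le> n1" and "n1 \<le> n" and "\<not> 2 dvd gcd n n1" and "n1 < m * (n - 1)"
    and "n2 < n - 1" and "n3 < n - 1"
    and "primitive_root_of_unity N \<omega>" and "\<omega>0 = \<omega> ^ n"
    and "i < m * (n - 1)"
    and "\<beta>1' = \<beta>1 * (\<omega>0 powi (- int (n1 * i)) - \<omega>0 powi (- int (m * n2 * i)))"
    and "\<beta>2' = (if \<beta>3 = 0
           then \<beta>2 * (\<omega>0 powi (- int (n1 * i)) - \<omega>0 powi (- int (m * n3 * i)))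
           else \<beta>2 * \<beta>3 powi (- int n) *
             (\<omega>0 powi int (n1 * i) - \<omega>0 powi ((2 * int n1 - int m * int n3) * int i)))"
    and "\<beta>1' \<noteq> 0 \<or> \<beta>2' \<noteq> 0"
  shows "\<exists>Rs :: ('k, (gen, 'k) free_alg set) module list.
      (\<forall>R\<in>set Rs. algebra (ring_of_type_algebra :: 'k ring) R \<and> local_cring R) \<and>
      alg_iso
        (summand_algebra n n1 q \<beta>1' \<beta>2' \<beta>3
           (\<omega> powi (2 * int n1 * int i - int m * int n * (int n2 + int n3) * int i)))
        (direct_sum_algebra (map (mat_algebra n) Rs)) \<noteq> {}"
proof -
  from assms show ?thesis
    using summand_algebra_splits[unfolded splits_into_local_matrix_algebras_def] by blast
qed

end
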